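(* Let $X$ be a birth-and-death continuous-time random walk with embedded Markov chain $(X_k)_{k\ge 0}$ having transition probabilities $p_i,q_i$, and with waiting times $\{\tau_i^+,\tau_i^-\mid i\ge 0\}$, and let $\delta_k$ ($k\ge 0$) and $\nu_i$ ($i\ge 0$) be the associated scale and speed measure. Then for every initial distribution of $X$ the following alternative holds: $$\mathsf P\{X\text{ implodes from }\infty\}=1 \iff \sum_{k=0}^\infty\Big(\sum_{i=k+1}^\infty\nu_i\Big)\delta_k<\infty\ \text{ and }\ \sum_{k=0}^\infty\delta_k=\infty,$$ $$\mathsf P\{X\text{ implodes from }\infty\}=0 \iff \sum_{k=0}^\infty\Big(\sum_{i=k+1}^\infty\nu_i\Big)\delta_k=\infty\ \text{ or }\ \sum_{k=0}^\infty\delta_k<\infty.$$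
   Context: Setting. $(X_k)_{k\ge0}$ is a Markov chain on $\{0,1,2,\dots\}$ with transition probabilities $p_{i,i+1}=p_i$, $p_{i,i-1}=q_i$, where $p_0=1$ (so $q_0=0$) and, for $i\ge1$, $p_i>0$, $q_i>0$, $p_i+q_i=1$. For each $i\ge 0$, $\tau_i^+$ and $\tau_i^-$ are (finite) positive random variables (right and left waiting times; their distributions are otherwise arbitrary), and $\{\tau_{i,k}^+\}_{k\ge0}$, $\{\tau_{i,k}^-\}_{k\ge0}$ are sequences of independent copies of $\tau_i^+$, $\tau_i^-$ respectively; all these sequences and the Markov chain $(X_k)$ are independent of each other. Put $T_0=0$ and $T_{k+1}=T_k+\tau^k$ for $k\ge0$, where $\tau^k=\tau_{i,k}^+$ if $X_k=i$ and $X_{k+1}=i+1$, and $\tau^k=\tau_{i,k}^-$ if $X_k=i$ and $X_{k+1}=i-1$. The continuous-time random walk is $X(t)=X_k$ for $t\in[T_k,T_{k+1})$, $k\ge0$ (so it is defined for $t<\lim_k T_k$). The initial distribution of $X$ is the law of $X_0$. Implosion. Let $\{Y_n\}_{n\ge1}$ be a sequence of independent processes, where each $Y_n$ is a continuous-time random walk with the same transition probabilities $p_i,q_i$ and the same waiting time distributions (those of $\tau_i^+,\tau_i^-$) as $X$, with $Y_n(0)=n$; that is, $Y_n$ has the law of the process $X(t)=X_k$, $t\in[T_k,T_{k+1})$, $k\ge0$, when the embedded Markov chain starts from $X_0=n$. Let $\theta_n=\inf\{t\ge0\mid Y_n(t)=n-1\}$, $n\ge1$ (with $\inf\emptyset=\infty$),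 and $\rho_\infty=\sum_{k=1}^\infty\theta_k$, which represents the first hitting time of $0$ when starting at infinity. $X$ implodes from $\infty$ on the event $\{\rho_\infty<\infty\}$ (so this event and its probability do not depend on the initial distribution of $X$). Scale and speed measure. $\mathsf E e^{-\tau_i}:=p_i\,\mathsf E e^{-\tau_i^+}+q_i\,\mathsf E e^{-\tau_i^-}$ (so $\mathsf E e^{-\tau_0}=\mathsf E e^{-\tau_0^+}$), $$\delta_k=\frac{q_1\cdots q_k}{p_1\cdots p_k},\ k\ge0,\qquad \nu_i=(1-\mathsf E e^{-\tau_i})\,\frac{p_1\cdots p_{i-1}}{q_1\cdots q_i},\ i\ge0,$$ where products over an empty set equal $1$; thus $\delta_0=1$, $\nu_0=1-\mathsf E e^{-\tau_0^+}$, $\nu_1=(1-\mathsf E e^{-\tau_1})/q_1$. All series have non-negative terms and take values in $[0,\infty]$. *)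

theory Defs
  imports "HOL-Probability.Probability"
begin

text \<open>Direction of a jump: \<open>Up\<close> indexes the right waiting times, \<open>Down\<close> the left ones.\<close>
datatype step = Up | Down

text \<open>
  \<open>\<mu> Up i\<close> and \<open>\<mu> Down i\<close> are the laws of the waiting times
  \<open>\<tau>\<^sub>i\<^sup>+\<close> and \<open>\<tau>\<^sub>i\<^sup>-\<close>; being laws on the reals, they are laws of finite random variables.
  Positivity is required almost surely.
\<close>
locale bd_data =
  fixes p q :: "nat \<Rightarrow> real" and \<mu> :: "step \<Rightarrow> nat \<Rightarrow> real measure"
  assumes p0: "p 0 = 1" and q0: "q 0 = 0"
    and p_pos: "\<And>i. i \<ge> 1 \<Longrightarrow> p i > 0"
    and q_pos: "\<And>i. i \<ge> 1 \<Longrightarrow> q i > 0"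
    and p_plus_q: "\<And>i. i \<ge> 1 \<Longrightarrow> p i + q i = 1"
    and waiting_prob: "\<And>s i. prob_space (\<mu> s i)"
    and waiting_sets: "\<And>s i. sets (\<mu> s i) = sets borel"
    and waiting_pos: "\<And>s i. AE x in \<mu> s i. 0 < x"

definition bd_trans :: "(nat \<Rightarrow> real) \<Rightarrow> (nat \<Rightarrow> real) \<Rightarrow> nat \<Rightarrow> nat \<Rightarrow> real" where
  "bd_trans p q i j = (if j = Suc i then p i else if i = Suc j then q i else 0)"

text \<open>
  A birth-and-death continuous-time random walk with initial distribution \<open>\<iota>\<close>, given by its
  embedded Markov chain \<open>X\<close> and the independent copies \<open>\<tau> s i k\<close> of the waiting times.
  The last two assumptions together say that the chain (as one random sequence) and all the
  \<open>\<tau> s i k\<close> are mutually independent. The chain's independence uses \<open>indep_set\<close> on generated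
  sigma-algebras since \<open>indep_var\<close> needs both variables to take values in the same type.
\<close>
locale bd_ctrw = bd_data p q \<mu> + prob_space M
  for M :: "'a measure" and p q :: "nat \<Rightarrow> real" and \<mu> :: "step \<Rightarrow> nat \<Rightarrow> real measure" +
  fixes \<iota> :: "nat pmf"
    and X :: "nat \<Rightarrow> 'a \<Rightarrow> nat"
    and \<tau> :: "step \<Rightarrow> nat \<Rightarrow> nat \<Rightarrow> 'a \<Rightarrow> real"
  assumes chain_measurable: "\<And>k. random_variable (count_space UNIV) (X k)"
    and initial: "distr M (count_space UNIV) (X 0) = measure_pmf \<iota>"
    and markov: "\<And>k x j. \<P>(\<omega> in M. \<forall>i\<le>k. X i \<omega> = x i) > 0 \<Longrightarrow>
        \<P>(\<omega> in M. X (Suc k) \<omega> = j \<bar> \<forall>i\<le>k. X i \<omega> = x i) = bd_trans p q (x k) j"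
    and waiting_law: "\<And>s i k. distr M borel (\<tau> s i k) = \<mu> s i"
    and waiting_indep: "indep_vars (\<lambda>_. borel) (\<lambda>(s, i, k). \<tau> s i k) UNIV"
    and chain_waiting_indep: "indep_set
        (sets (vimage_algebra (space M) (\<lambda>\<omega> k. X k \<omega>) (\<Pi>\<^sub>M k\<in>UNIV. count_space UNIV)))
        (sets (vimage_algebra (space M) (\<lambda>\<omega> (s, i, k). \<tau> s i k \<omega>) (\<Pi>\<^sub>M j\<in>UNIV. borel)))"

text \<open>
  Almost surely the chain only moves to neighbours, so a step that is not upward is downward.
\<close>
definition waiting ::
    "(nat \<Rightarrow> 'a \<Rightarrow> nat) \<Rightarrow> (step \<Rightarrow> nat \<Rightarrow> nat \<Rightarrow> 'a \<Rightarrow> real) \<Rightarrow> nat \<Rightarrow> 'a \<Rightarrow> real" where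
  "waiting X \<tau> k \<omega> =
     (if X (Suc k) \<omega> = X k \<omega> + 1 then \<tau> Up (X k \<omega>) k \<omega> else \<tau> Down (X k \<omega>) k \<omega>)"

definition jump_time ::
    "(nat \<Rightarrow> 'a \<Rightarrow> nat) \<Rightarrow> (step \<Rightarrow> nat \<Rightarrow> nat \<Rightarrow> 'a \<Rightarrow> real) \<Rightarrow> nat \<Rightarrow> 'a \<Rightarrow> real" where
  "jump_time X \<tau> k \<omega> = (\<Sum>j<k. waiting X \<tau> j \<omega>)"

text \<open>
  The value at time \<open>t\<close> is \<open>None\<close> from the explosion time onwards. Almost surely the waiting times
  are positive, and then the index \<open>k\<close> is unique.
\<close>
definition walk ::
    "(nat \<Rightarrow> 'a \<Rightarrow> nat) \<Rightarrow> (step \<Rightarrow> nat \<Rightarrow> nat \<Rightarrow> 'a \<Rightarrow> real) \<Rightarrow> real \<Rightarrow> 'a \<Rightarrow> nat option" where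
  "walk X \<tau> t \<omega> =
     (if \<exists>k. t \<in> {jump_time X \<tau> k \<omega>..<jump_time X \<tau> (Suc k) \<omega>}
      then Some (X (LEAST k. t \<in> {jump_time X \<tau> k \<omega>..<jump_time X \<tau> (Suc k) \<omega>}) \<omega>)
      else None)"

text \<open>
  Independent walks \<open>Y\<^sub>n = walk (Z n) (\<sigma> n)\<close>, \<open>n \<ge> 1\<close>, with \<open>Y\<^sub>n\<close> started from \<open>n\<close>.
  Independence is that of the processes \<open>(Y\<^sub>n(t))\<close>, \<open>t \<ge> 0\<close>; nothing is assumed
  about the joint law of the underlying chains and waiting times for different \<open>n\<close>.
\<close>
locale implosion_walks = prob_space N
  for N :: "'b measure" +
  fixes p q :: "nat \<Rightarrow> real" and \<mu> :: "step \<Rightarrow> nat \<Rightarrow> real measure"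
    and Z :: "nat \<Rightarrow> nat \<Rightarrow> 'b \<Rightarrow> nat"
    and \<sigma> :: "nat \<Rightarrow> step \<Rightarrow> nat \<Rightarrow> nat \<Rightarrow> 'b \<Rightarrow> real"
  assumes walks: "\<And>n. n \<ge> 1 \<Longrightarrow> bd_ctrw N p q \<mu> (return_pmf n) (Z n) (\<sigma> n)"
    and walks_indep: "indep_vars (\<lambda>_. \<Pi>\<^sub>M t\<in>{0..}. count_space UNIV)
        (\<lambda>n \<omega>. \<lambda>t\<in>{0..}. walk (Z n) (\<sigma> n) t \<omega>) {1..}"

definition hitting_theta ::
    "(nat \<Rightarrow> nat \<Rightarrow> 'b \<Rightarrow> nat) \<Rightarrow> (nat \<Rightarrow> step \<Rightarrow> nat \<Rightarrow> nat \<Rightarrow> 'b \<Rightarrow> real) \<Rightarrow> nat \<Rightarrow> 'b \<Rightarrow> ennreal" where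
  "hitting_theta Z \<sigma> n \<omega> = Inf {ennreal t |t. 0 \<le> t \<and> walk (Z n) (\<sigma> n) t \<omega> = Some (n - 1)}"

definition rho_infinity ::
    "(nat \<Rightarrow> nat \<Rightarrow> 'b \<Rightarrow> nat) \<Rightarrow> (nat \<Rightarrow> step \<Rightarrow> nat \<Rightarrow> nat \<Rightarrow> 'b \<Rightarrow> real) \<Rightarrow> 'b \<Rightarrow> ennreal" where
  "rho_infinity Z \<sigma> \<omega> = (\<Sum>k. hitting_theta Z \<sigma> (Suc k) \<omega>)"

definition exp_waiting ::
    "(nat \<Rightarrow> real) \<Rightarrow> (nat \<Rightarrow> real) \<Rightarrow> (step \<Rightarrow> nat \<Rightarrow> real measure) \<Rightarrow> nat \<Rightarrow> real" where
  "exp_waiting p q \<mu> i = p i * (\<integral>x. exp (- x) \<partial>\<mu> Up i) + q i * (\<integral>x. exp (- x) \<partial>\<mu> Down i)"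

definition scale_delta :: "(nat \<Rightarrow> real) \<Rightarrow> (nat \<Rightarrow> real) \<Rightarrow> nat \<Rightarrow> real" where
  "scale_delta p q k = (\<Prod>j=1..k. q j) / (\<Prod>j=1..k. p j)"

definition speed_nu ::
    "(nat \<Rightarrow> real) \<Rightarrow> (nat \<Rightarrow> real) \<Rightarrow> (step \<Rightarrow> nat \<Rightarrow> real measure) \<Rightarrow> nat \<Rightarrow> real" where
  "speed_nu p q \<mu> i = (1 - exp_waiting p q \<mu> i) * ((\<Prod>j=1..<i. p j) / (\<Prod>j=1..i. q j))"

text \<open>The inner sum over \<open>i\<close> is the tail of the speed measure from index \<open>k + 1\<close> on.\<close>
definition implosion_series ::
    "(nat \<Rightarrow> real) \<Rightarrow> (nat \<Rightarrow> real) \<Rightarrow> (step \<Rightarrow> nat \<Rightarrow> real measure) \<Rightarrow> ennreal" where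
  "implosion_series p q \<mu> =
     (\<Sum>k. (\<Sum>i. ennreal (speed_nu p q \<mu> (k + 1 + i))) * ennreal (scale_delta p q k))"

end

theory Submission
  imports Defs
begin

text \<open>
  Let \<open>\<phi>\<^sub>n = E (exp (- \<theta>\<^sub>n))\<close>, with \<open>exp (- \<infinity>) = 0\<close>, and let \<open>G\<^sub>n = \<phi>\<^sub>1 \<dots> \<phi>\<^sub>n\<close>. Independence gives
  \<open>E (exp (- \<rho>\<^sub>\<infinity>)) \<le> G\<^sub>n\<close> for every \<open>n\<close>. It is shown that \<open>\<rho>\<^sub>\<infinity> < \<infinity>\<close> almost surely if the implosion series
  converges and \<open>\<Sum>\<delta>\<^sub>k = \<infinity>\<close>, and that \<open>\<rho>\<^sub>\<infinity> = \<infinity>\<close> almost surely otherwise. Since these two cases are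
  complementary, both equivalences follow, and no zero-one law is needed.

  Conditioning on the path of the embedded chain makes \<open>\<phi>\<^sub>n\<close> a first-passage function of a chain that
  moves with the damped weights \<open>u\<^sub>i = p\<^sub>i E (exp (- \<tau>\<^sub>i\<^sup>+))\<close> and \<open>d\<^sub>i = q\<^sub>i E (exp (- \<tau>\<^sub>i\<^sup>-))\<close>, and is killed in
  state \<open>i\<close> with probability \<open>m\<^sub>i = 1 - E (exp (- \<tau>\<^sub>i))\<close> (\<open>nn_integral_exp_neg_hitting_theta\<close>). The rest is
  analysis of these passage functions, based on the identity \<open>q\<^sub>i \<delta>\<^sub>i\<^sub>-\<^sub>1 = p\<^sub>i \<delta>\<^sub>i\<close>.

  Convergence. If \<open>\<Sum>\<delta>\<^sub>k = \<infinity>\<close> then \<open>1 - \<phi>\<^sub>n \<le> \<delta>\<^sub>n\<^sub>-\<^sub>1 (\<nu>\<^sub>n + \<nu>\<^sub>n\<^sub>+\<^sub>1 + \<dots>)\<close> (\<open>defect_le_speed_tail\<close>), so the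
  implosion series bounds \<open>\<Sum>E (1 - exp (- \<theta>\<^sub>n))\<close>, and \<open>\<Sum>(1 - exp (- \<theta>\<^sub>n))\<close> converges almost surely. The
  same bound for \<open>exp (- c \<theta>\<^sub>n)\<close> at \<open>c = 0\<close> shows that every \<open>\<theta>\<^sub>n\<close> is finite almost surely. Hence \<open>\<Sum>\<theta>\<^sub>n\<close>
  converges.

  Divergence. If \<open>\<Sum>\<delta>\<^sub>k < \<infinity>\<close>, then \<open>\<phi>\<^sub>n\<close> is at most the probability of ever reaching \<open>n - 1\<close> from \<open>n\<close>,
  which is the ratio of two consecutive tails of \<open>\<Sum>\<delta>\<^sub>k\<close>; the product of these ratios telescopes, so
  \<open>G\<^sub>n\<close> tends to 0. In general the drops \<open>D\<^sub>n = G\<^sub>n\<^sub>-\<^sub>1 - G\<^sub>n\<close> satisfy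
  \<open>q\<^sub>n D\<^sub>n \<ge> m\<^sub>n G\<^sub>n\<^sub>+\<^sub>1 + p\<^sub>n D\<^sub>n\<^sub>+\<^sub>1\<close> (\<open>G_drop_step\<close>), whence
  \<open>D\<^sub>n \<ge> \<delta>\<^sub>n\<^sub>-\<^sub>1 (\<nu>\<^sub>n + \<nu>\<^sub>n\<^sub>+\<^sub>1 + \<dots>) lim G\<close>. The drops sum to at most 1, so divergence of the implosion series
  forces \<open>lim G = 0\<close> (\<open>G_tendsto_0_of_series\<close>).
\<close>

section \<open>Passage functions of a damped birth-and-death chain\<close>

text \<open>
  \<open>first_passage u d a m i\<close> is the total weight of all nearest-neighbour paths from \<open>i\<close> that reach
  \<open>a\<close> for the first time, in at most \<open>m\<close> steps, an up-step from \<open>j\<close> weighing \<open>u j\<close> and a down-step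
  \<open>d j\<close>. For the walks considered \<open>d 0 = 0\<close>, so the value \<open>0 - 1 = 0\<close> is irrelevant.
\<close>
primrec first_passage :: "(nat \<Rightarrow> real) \<Rightarrow> (nat \<Rightarrow> real) \<Rightarrow> nat \<Rightarrow> nat \<Rightarrow> nat \<Rightarrow> real" where
  "first_passage u d a 0 i = (if i = a then 1 else 0)"
| "first_passage u d a (Suc m) i =
     (if i = a then 1 else u i * first_passage u d a m (Suc i) + d i * first_passage u d a m (i - 1))"

text \<open>
  The weight of all first-passage paths from \<open>i\<close> to \<open>a\<close>. With \<open>u i = p i * E (exp (- c * \<tau> Up i))\<close> and
  \<open>d i = q i * E (exp (- c * \<tau> Down i))\<close> this is the Laplace transform at \<open>c\<close> of the hitting time of \<open>a\<close>.
\<close>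
definition passage :: "(nat \<Rightarrow> real) \<Rightarrow> (nat \<Rightarrow> real) \<Rightarrow> nat \<Rightarrow> nat \<Rightarrow> real" where
  "passage u d a i = (SUP m. first_passage u d a m i)"

text \<open>
  A birth-and-death chain \<open>p, q\<close> with step weights \<open>u \<le> p\<close> and \<open>d \<le> q\<close>: in state \<open>i\<close> the walker is
  killed with probability \<open>1 - u i - d i\<close>.
\<close>
locale damped_walk =
  fixes p q u d :: "nat \<Rightarrow> real"
  assumes p_pos: "\<And>i. i \<ge> 1 \<Longrightarrow> p i > 0"
    and q_pos: "\<And>i. i \<ge> 1 \<Longrightarrow> q i > 0"
    and p_plus_q: "\<And>i. p i + q i = 1"
    and p_nonneg: "\<And>i. 0 \<le> p i" and q_nonneg: "\<And>i. 0 \<le> q i"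
    and u: "\<And>i. 0 \<le> u i" "\<And>i. u i \<le> p i"
    and d: "\<And>i. 0 \<le> d i" "\<And>i. d i \<le> q i"
begin

abbreviation "\<delta> \<equiv> scale_delta p q"

text \<open>
  The speed measure built from the killing probabilities; it is the usual one when the weights are
  the Laplace transforms at 1.
\<close>
definition nu :: "nat \<Rightarrow> real" where
  "nu i = (1 - u i - d i) * ((\<Prod>j=1..<i. p j) / (\<Prod>j=1..i. q j))"

abbreviation "F \<equiv> first_passage u d"
abbreviation "\<Phi> \<equiv> passage u d"

lemma killing_nonneg: "0 \<le> 1 - u i - d i"
  using u(2)[of i] d(2)[of i] p_plus_q[of i] by linarith

lemma q_eq: "q i = 1 - p i"
  using p_plus_q[of i] by linarith

lemma delta_pos: "\<delta> k > 0"
  unfolding scale_delta_def using p_pos q_pos by (intro divide_pos_pos prod_pos) auto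

lemma delta_0: "\<delta> 0 = 1"
  by (simp add: scale_delta_def)

lemma delta_step: "n \<ge> 1 \<Longrightarrow> p n * \<delta> n = q n * \<delta> (n - 1)"
  using p_pos[of n] by (cases n) (auto simp: scale_delta_def field_simps)

lemma nu_nonneg: "0 \<le> nu i"
  unfolding nu_def using p_pos q_pos
  by (intro mult_nonneg_nonneg killing_nonneg divide_nonneg_nonneg prod_nonneg)
     (auto intro: less_imp_le)

text \<open>
  Together with \<open>delta_step\<close>, this turns the inequalities
  \<open>q i * D i \<le> (1 - u i - d i) + p i * D (Suc i)\<close> and their reverses into telescoping ones for
  \<open>D i / \<delta> (i - 1)\<close>, with increments \<open>nu i\<close>.
\<close>
lemma nu_delta:
  assumes "n \<ge> 1"
  shows "q n * \<delta> (n - 1) * nu n = 1 - u n - d n"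
proof -
  obtain k where n: "n = Suc k" using assms by (cases n) auto
  have "(\<Prod>j=1..k. p j) > 0" "(\<Prod>j=1..k. q j) > 0"
    using p_pos q_pos by (auto intro!: prod_pos)
  then have "(\<Prod>j=1..k. p j) \<noteq> 0" "(\<Prod>j=1..k. q j) \<noteq> 0"
    by linarith+
  moreover have "{1..<Suc k} = {1..k}" "q (Suc k) \<noteq> 0" using q_pos[OF assms] n by auto
  moreover have "q n * (Q / P) * (m * (P / (Q * q n))) = m" if "P \<noteq> 0" "Q \<noteq> 0" "q n \<noteq> 0" for P Q m
    using that by (simp add: field_simps)
  ultimately show ?thesis
    unfolding n scale_delta_def nu_def by (simp only: prod.cl_ivl_Suc) simp
qed

lemma first_passage_bounds: "0 \<le> F a m i \<and> F a m i \<le> 1"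
proof (induction m arbitrary: i)
  case (Suc m)
  have "u i * F a m (Suc i) + d i * F a m (i - 1) \<le> u i * 1 + d i * 1"
    using Suc u d by (intro add_mono mult_left_mono) auto
  also have "\<dots> \<le> 1" using killing_nonneg[of i] by simp
  finally show ?case using Suc u d by auto
qed auto

lemma first_passage_mono: "F a m i \<le> F a (Suc m) i"
proof (induction m arbitrary: i)
  case 0
  then show ?case using u d by auto
next
  case (Suc m)
  have "u i * F a m (Suc i) + d i * F a m (i - 1) \<le> u i * F a (Suc m) (Suc i) + d i * F a (Suc m) (i - 1)"
    by (intro add_mono mult_left_mono Suc u d)
  then show ?case by auto
qed

lemma first_passage_tendsto: "(\<lambda>m. F a m i) \<longlonglongrightarrow> \<Phi> a i"
  unfolding passage_def
proof (rule LIMSEQ_incseq_SUP)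
  show "bdd_above (range (\<lambda>m. F a m i))" using first_passage_bounds by (auto intro!: bdd_aboveI[of _ 1])
  show "incseq (\<lambda>m. F a m i)" using first_passage_mono by (rule incseq_SucI)
qed

lemma passage_bounds: "0 \<le> \<Phi> a i" "\<Phi> a i \<le> 1"
  using first_passage_bounds by (auto intro!: LIMSEQ_le_const[OF first_passage_tendsto] LIMSEQ_le_const2[OF first_passage_tendsto])

lemma passage_self: "\<Phi> a a = 1"
proof -
  have "F a m a = 1" for m by (cases m) auto
  then show ?thesis by (simp add: passage_def)
qed

lemma passage_rec:
  assumes "i \<noteq> a"
  shows "\<Phi> a i = u i * \<Phi> a (Suc i) + d i * \<Phi> a (i - 1)"
proof (rule LIMSEQ_unique)
  show "(\<lambda>m. F a (Suc m) i) \<longlonglongrightarrow> \<Phi> a i"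
    by (rule LIMSEQ_Suc[OF first_passage_tendsto])
  show "(\<lambda>m. F a (Suc m) i) \<longlonglongrightarrow> u i * \<Phi> a (Suc i) + d i * \<Phi> a (i - 1)"
    using assms by (auto intro!: tendsto_intros first_passage_tendsto)
qed

text \<open>
  In the recurrent case the defect \<open>1 - \<Phi> (n - 1) n\<close> is at most its linearisation
  \<open>\<delta> (n - 1) * (\<Sum>i\<ge>n. nu i)\<close>. Let \<open>H = 1 - \<Phi> (n - 1)\<close>. Iterating the telescoping inequality for
  \<open>w i = (H i - H (i - 1)) / \<delta> (i - 1)\<close> gives \<open>w n - (\<Sum>i\<ge>n. nu i) \<le> w j\<close> for all \<open>j \<ge> n\<close>; if the
  left side were positive, summing against \<open>\<delta> (j - 1)\<close> would bound \<open>\<Sum>\<delta>\<close>, because \<open>H\<close> lies in \<open>[0,1]\<close>.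
\<close>
lemma defect_le_speed_tail:
  assumes n: "n \<ge> 1" and rec: "\<not> summable \<delta>" and sm: "summable nu"
  shows "1 - \<Phi> (n - 1) n \<le> \<delta> (n - 1) * (\<Sum>i. nu (n + i))"
proof -
  define H where "H i = 1 - \<Phi> (n - 1) i" for i
  define w where "w i = (H i - H (i - 1)) / \<delta> (i - 1)" for i
  define t where "t = (\<Sum>i. nu (n + i))"
  have H01: "0 \<le> H i" "H i \<le> 1" for i using passage_bounds[of "n-1" i] by (auto simp: H_def)
  have w_step: "w i \<le> nu i + w (Suc i)" if "i \<ge> n" for i
  proof -
    have i1: "i \<ge> 1" and ne: "i \<noteq> n - 1" using that n by auto
    have "H i = (1 - u i - d i) + u i * H (Suc i) + d i * H (i - 1)"
      unfolding H_def using passage_rec[OF ne] by (simp add: algebra_simps)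
    also have "\<dots> \<le> (1 - u i - d i) + p i * H (Suc i) + q i * H (i - 1)"
      by (intro add_mono mult_right_mono u d H01 order_refl)
    finally have "q i * (H i - H (i - 1)) \<le> (1 - u i - d i) + p i * (H (Suc i) - H i)"
      unfolding q_eq by (simp add: algebra_simps)
    also have "p i * (H (Suc i) - H i) = q i * \<delta> (i - 1) * w (Suc i)"
      using delta_pos[of i] delta_step[OF i1, symmetric] by (simp add: w_def)
    also have "1 - u i - d i = q i * \<delta> (i - 1) * nu i"
      using nu_delta[OF i1] by simp
    also have "q i * (H i - H (i - 1)) = q i * \<delta> (i - 1) * w i"
      using delta_pos[of "i-1"] by (simp add: w_def)
    finally have "q i * \<delta> (i - 1) * w i \<le> q i * \<delta> (i - 1) * (nu i + w (Suc i))"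
      by (simp only: distrib_left)
    moreover have "q i * \<delta> (i - 1) > 0" using q_pos[OF i1] delta_pos by simp
    ultimately show ?thesis by (simp only: mult_le_cancel_left_pos)
  qed
  have w_iter: "w n \<le> (\<Sum>i<k. nu (n + i)) + w (n + k)" for k
  proof (induction k)
    case (Suc k)
    then show ?case using w_step[of "n + k"] by simp
  qed simp
  have sm': "summable (\<lambda>i. nu (n + i))" using sm by (simp add: summable_iff_shift add.commute)
  have wt: "w n - t \<le> w (n + k)" for k
    using w_iter[of k] sum_le_suminf[OF sm', of "{..<k}"] nu_nonneg by (simp add: t_def)
  have "w n \<le> t"
  proof (rule ccontr)
    assume "\<not> w n \<le> t"
    then have pos: "w n - t > 0" by simp
    have "(\<Sum>k<N. \<delta> (k + (n - 1))) \<le> 1 / (w n - t)" for N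
    proof -
      \<comment> \<open>The increments \<open>\<delta> (j - 1) * w j = H j - H (j - 1)\<close> telescope.\<close>
      have "(\<Sum>k<N. \<delta> (k + (n - 1))) * (w n - t) = (\<Sum>k<N. \<delta> (n + k - 1) * (w n - t))"
        using n by (simp add: sum_distrib_right add.commute)
      also have "\<dots> \<le> (\<Sum>k<N. \<delta> (n + k - 1) * w (n + k))"
        by (intro sum_mono mult_left_mono wt less_imp_le delta_pos)
      also have "\<dots> = (\<Sum>k<N. H (n - 1 + Suc k) - H (n - 1 + k))"
        using n delta_pos by (intro sum.cong) (auto simp: w_def less_imp_neq[OF delta_pos, symmetric])
      also have "\<dots> = H (n - 1 + N) - H (n - 1)"
        using sum_lessThan_telescope[of "\<lambda>k. H (n - 1 + k)" N] by simp
      also have "\<dots> \<le> 1" using H01(2)[of "n - 1 + N"] H01(1)[of "n - 1"] by linarith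
      finally show ?thesis using pos by (simp add: field_simps)
    qed
    then have "summable (\<lambda>k. \<delta> (k + (n - 1)))"
      using delta_pos by (intro summableI_nonneg_bounded) (auto intro: less_imp_le)
    with rec show False by (simp add: summable_iff_shift)
  qed
  moreover have "1 - \<Phi> (n - 1) n = \<delta> (n - 1) * w n"
    using delta_pos[of "n-1"] passage_self[of "n-1"] by (simp add: w_def H_def)
  ultimately show ?thesis
    using delta_pos[of "n-1"] unfolding t_def by (simp add: mult_left_mono)
qed

text \<open>
  The ratio on the right is the probability that the undamped transient chain ever moves from \<open>n\<close>
  to \<open>n - 1\<close>. As a function of the starting point, \<open>\<Sum>k\<ge>i. \<delta> k\<close> is harmonic for \<open>p, q\<close> at \<open>i \<ge> 1\<close>, and a
  non-negative harmonic function dominates the passage functions.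
\<close>
lemma passage_le_scale_ratio:
  assumes n: "n \<ge> 1" and sm: "summable \<delta>"
  shows "\<Phi> (n - 1) n \<le> (\<Sum>k. \<delta> (k + n)) / (\<Sum>k. \<delta> (k + (n - 1)))"
proof -
  define r where "r i = (\<Sum>k. \<delta> (k + i))" for i
  have sm': "summable (\<lambda>k. \<delta> (k + i))" for i using sm by (simp add: summable_iff_shift)
  have r_pos: "r i > 0" for i unfolding r_def by (intro suminf_pos sm' delta_pos)
  have r_step: "r i = \<delta> i + r (Suc i)" for i
    using suminf_split_head[OF sm'[of i]] by (simp add: r_def)
  have r_harm: "r i = p i * r (Suc i) + q i * r (i - 1)" if "i \<ge> 1" for i
  proof -
    have "r (Suc i) = r i - \<delta> i" "r (i - 1) = r i + \<delta> (i - 1)"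
      using r_step[of i] r_step[of "i-1"] that by auto
    then have "p i * r (Suc i) + q i * r (i - 1) = (p i + q i) * r i - (p i * \<delta> i - q i * \<delta> (i - 1))"
      by (simp only:) (simp add: algebra_simps)
    then show ?thesis using delta_step[OF that] by (simp add: p_plus_q)
  qed
  have "F (n - 1) m i \<le> r i / r (n - 1)" if "i \<ge> n - 1" for m i
    using that
  proof (induction m arbitrary: i)
    case 0
    then show ?case using r_pos[of i] r_pos[of "n-1"] by auto
  next
    case (Suc m)
    show ?case
    proof (cases "i = n - 1")
      case True
      then show ?thesis using r_pos[of i] by simp
    next
      case False
      then have "u i * F (n - 1) m (Suc i) + d i * F (n - 1) m (i - 1)
          \<le> p i * (r (Suc i) / r (n - 1)) + q i * (r (i - 1) / r (n - 1))"
        using Suc first_passage_bounds u d p_nonneg q_nonneg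
        by (intro add_mono mult_mono) auto
      also have "\<dots> = r i / r (n - 1)"
        using r_harm[of i] False Suc.prems by (simp add: add_divide_distrib)
      finally show ?thesis using False by simp
    qed
  qed
  then show ?thesis unfolding r_def[symmetric]
    by (intro LIMSEQ_le_const2[OF first_passage_tendsto]) auto
qed

text \<open>
  One half of the strong Markov property: going from \<open>n + 1\<close> to \<open>n - 1\<close> requires passing through \<open>n\<close>.
\<close>
lemma passage_submult: "n \<ge> 1 \<Longrightarrow> \<Phi> (n - 1) (Suc n) \<le> \<Phi> n (Suc n) * \<Phi> (n - 1) n"
proof -
  assume n: "n \<ge> 1"
  have "F (n - 1) m i \<le> F n m i * \<Phi> (n - 1) n" if "i \<ge> n" for m i
    using that
  proof (induction m arbitrary: i)
    case 0
    then show ?case using n passage_bounds by auto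
  next
    case (Suc m)
    show ?case
    proof (cases "i = n")
      case True
      have "F (n - 1) (Suc m) n \<le> \<Phi> (n - 1) n"
        by (intro incseq_le[OF incseq_SucI first_passage_tendsto] first_passage_mono)
      then show ?thesis using True by simp
    next
      case False
      then have "u i * F (n - 1) m (Suc i) + d i * F (n - 1) m (i - 1)
          \<le> u i * (F n m (Suc i) * \<Phi> (n - 1) n) + d i * (F n m (i - 1) * \<Phi> (n - 1) n)"
        using Suc by (intro add_mono mult_left_mono u d) auto
      then show ?thesis using False Suc.prems n by (auto simp: algebra_simps)
    qed
  qed
  then show ?thesis
    by (intro LIMSEQ_le[OF first_passage_tendsto tendsto_mult_right[OF first_passage_tendsto]]) auto
qed

text \<open>
  The weight of the descents from \<open>n\<close> to 0, one level after the other. When the weights are the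
  Laplace transforms at 1, it is \<open>E (exp (- (\<theta>\<^sub>1 + \<dots> + \<theta>\<^sub>n)))\<close>.
\<close>
definition G :: "nat \<Rightarrow> real" where "G n = (\<Prod>k=1..n. \<Phi> (k - 1) k)"

lemma G_Suc: "G (Suc n) = G n * \<Phi> n (Suc n)"
  by (simp add: G_def)

lemma G_nonneg: "0 \<le> G n"
  unfolding G_def using passage_bounds by (auto intro!: prod_nonneg)

lemma G_0: "G 0 = 1"
  by (simp add: G_def)

lemma G_decseq: "decseq G"
  using passage_bounds G_nonneg by (auto intro!: decseq_SucI mult_left_le simp: G_Suc)

text \<open>
  The first-step inequality for \<open>G\<close>, freed from the damping of the step weights. In
  \<open>G n \<le> u n * G (n + 1) + d n * G (n - 1)\<close> the weight \<open>u n\<close> falls short of \<open>p n\<close> by at most the killing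
  probability, and this is absorbed by replacing the killing term \<open>G n\<close> by \<open>G (n + 1)\<close>.
\<close>
lemma G_drop_step:
  assumes n: "n \<ge> 1"
  shows "(1 - u n - d n) * G (Suc n) + p n * (G n - G (Suc n)) \<le> q n * (G (n - 1) - G n)"
proof -
  obtain k where k: "n = Suc k" using n by (cases n) auto
  have "\<Phi> k (Suc k) \<le> u n * (\<Phi> n (Suc n) * \<Phi> k (Suc k)) + d n"
    using passage_rec[of n k] passage_submult[OF n] mult_left_mono[OF passage_submult[OF n] u(1)[of n]]
    by (simp add: k passage_self)
  then have "G k * \<Phi> k (Suc k) \<le> G k * (u n * (\<Phi> n (Suc n) * \<Phi> k (Suc k)) + d n)"
    by (rule mult_left_mono) (rule G_nonneg)
  then have rec: "G n \<le> u n * G (Suc n) + d n * G k"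
    by (simp add: k G_Suc algebra_simps)
  have dec: "G (Suc n) \<le> G n" "G n \<le> G k" using G_decseq by (auto simp: k decseq_Suc_iff)
  have a: "d n * (G k - G n) \<le> q n * (G k - G n)" using dec by (intro mult_right_mono d) auto
  have b: "(p n - u n) * (G n - G (Suc n)) \<le> (1 - u n - d n) * (G n - G (Suc n))"
    using dec d(2)[of n] p_plus_q[of n] by (intro mult_right_mono) auto
  show ?thesis using rec a b by (simp add: k algebra_simps)
qed

lemma G_drop_ge:
  assumes n: "n \<ge> 1" and g: "0 \<le> g" "\<And>k. g \<le> G k"
  shows "\<delta> (n - 1) * (\<Sum>i<k. nu (n + i)) * g \<le> G (n - 1) - G n"
proof -
  define w where "w i = (G (i - 1) - G i) / \<delta> (i - 1)" for i
  have w_step: "nu i * g + w (Suc i) \<le> w i" if "i \<ge> 1" for i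
  proof -
    have "q i * \<delta> (i - 1) * (nu i * g + w (Suc i)) = (1 - u i - d i) * g + p i * (G i - G (Suc i))"
    proof -
      have "q i * \<delta> (i - 1) * w (Suc i) = p i * (G i - G (Suc i))"
        using delta_pos[of i] delta_step[OF that, symmetric] by (simp add: w_def)
      then show ?thesis
        using nu_delta[OF that] by (simp only: distrib_left mult.assoc[symmetric])
    qed
    also have "\<dots> \<le> (1 - u i - d i) * G (Suc i) + p i * (G i - G (Suc i))"
      by (intro add_mono mult_left_mono g killing_nonneg order_refl)
    also have "\<dots> \<le> q i * \<delta> (i - 1) * w i"
      using G_drop_step[OF that] delta_pos[of "i-1"] by (simp add: w_def)
    finally show ?thesis using q_pos[OF that] delta_pos[of "i-1"]
      by (simp add: mult_le_cancel_left_pos)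
  qed
  have "(\<Sum>i<k. nu (n + i)) * g + w (n + k) \<le> w n" for k
  proof (induction k)
    case (Suc k)
    then show ?case using w_step[of "n + k"] n by (simp add: algebra_simps)
  qed simp
  from this[of k] have "(\<Sum>i<k. nu (n + i)) * g \<le> w n"
  proof -
    have "0 \<le> w (n + k)"
      unfolding w_def using G_decseq delta_pos[of "n+k-1"]
      by (intro divide_nonneg_pos) (auto dest: decseqD[of G "n+k-1" "n+k"])
    then show ?thesis using \<open>(\<Sum>i<k. nu (n + i)) * g + w (n + k) \<le> w n\<close> by linarith
  qed
  then have "\<delta> (n - 1) * ((\<Sum>i<k. nu (n + i)) * g) \<le> \<delta> (n - 1) * w n"
    using delta_pos[of "n-1"] by (intro mult_left_mono) auto
  then show ?thesis using delta_pos[of "n-1"] by (simp add: w_def mult.assoc)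
qed

text \<open>
  The implosion series of the damped chain.
\<close>
definition series :: ennreal where
  "series = (\<Sum>k. (\<Sum>i. ennreal (nu (k + 1 + i))) * ennreal (\<delta> k))"

text \<open>
  With \<open>g = lim G\<close>, summing \<open>G_drop_ge\<close> over \<open>n\<close> gives \<open>series * g \<le> G 0 - g \<le> 1\<close>.
\<close>
lemma G_tendsto_0_of_series:
  assumes "series = \<infinity>"
  shows "G \<longlonglongrightarrow> 0"
proof -
  obtain g where g: "G \<longlonglongrightarrow> g" "\<And>i. g \<le> G i"
    using decseq_convergent[OF G_decseq, of 0] G_nonneg by auto
  have g0: "0 \<le> g" using G_nonneg by (intro LIMSEQ_le_const[OF g(1)]) auto
  have 1: "(\<Sum>i. ennreal (nu (k + 1 + i))) * ennreal (\<delta> k) * ennreal g \<le> ennreal (G k - G (Suc k))" for k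
  proof -
    have "(\<Sum>i<l. ennreal (nu (k + 1 + i))) * ennreal (\<delta> k) * ennreal g \<le> ennreal (G k - G (Suc k))" for l
      using G_drop_ge[of "k + 1" g l] g(2) g0 delta_pos[of k] nu_nonneg
      by (subst sum_ennreal) (auto simp: ennreal_mult'[symmetric] sum_nonneg mult_ac intro!: ennreal_leI)
    then have "(SUP l. (\<Sum>i<l. ennreal (nu (k + 1 + i))) * (ennreal (\<delta> k) * ennreal g)) \<le> ennreal (G k - G (Suc k))"
      by (intro SUP_least) (simp add: mult.assoc)
    then show ?thesis
      by (simp only: suminf_eq_SUP SUP_mult_right_ennreal[symmetric] mult.assoc)
  qed
  have "series * ennreal g = (\<Sum>k. (\<Sum>i. ennreal (nu (k + 1 + i))) * ennreal (\<delta> k) * ennreal g)"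
    by (simp add: series_def)
  also have "\<dots> \<le> (\<Sum>k. ennreal (G k - G (Suc k)))"
    by (intro suminf_le 1) auto
  also have "\<dots> \<le> 1"
  proof (rule suminf_le_const)
    fix N
    have "(\<Sum>k<N. ennreal (G k - G (Suc k))) = ennreal (\<Sum>k<N. G k - G (Suc k))"
      using G_decseq by (intro sum_ennreal) (auto simp: decseq_Suc_iff)
    also have "(\<Sum>k<N. G k - G (Suc k)) = 1 - G N"
      by (simp add: sum_lessThan_telescope' G_0)
    finally show "(\<Sum>k<N. ennreal (G k - G (Suc k))) \<le> 1"
      using G_nonneg[of N] by (simp add: ennreal_le_1)
  qed auto
  finally have "g = 0"
    using assms g0 by (cases "g = 0") (auto simp: ennreal_top_mult top_unique)
  then show ?thesis using g(1) by simp
qed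

lemma G_tendsto_0_of_transient:
  assumes "summable \<delta>"
  shows "G \<longlonglongrightarrow> 0"
proof -
  define r where "r i = (\<Sum>k. \<delta> (k + i))" for i
  have r_pos: "r i > 0" for i
    using assms unfolding r_def by (intro suminf_pos delta_pos) (simp add: summable_iff_shift)
  have "G n \<le> r n / r 0" for n
  proof (induction n)
    case 0
    then show ?case using r_pos[of 0] by (simp add: G_0)
  next
    case (Suc n)
    have "G (Suc n) \<le> (r n / r 0) * (r (Suc n) / r n)"
      unfolding G_Suc using passage_le_scale_ratio[of "Suc n"] assms Suc passage_bounds
        divide_nonneg_nonneg[OF less_imp_le less_imp_le, OF r_pos r_pos, of n 0]
      by (intro mult_mono) (auto simp: r_def)
    then show ?case using r_pos[of n] by simp
  qed
  moreover have "(\<lambda>n. r n / r 0) \<longlonglongrightarrow> 0 / r 0"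
    unfolding r_def by (intro tendsto_divide suminf_exist_split2 assms tendsto_const)
      (use r_pos[of 0] in \<open>auto simp: r_def\<close>)
  ultimately show ?thesis using G_nonneg
    by (intro tendsto_sandwich[of "\<lambda>_. 0" G sequentially "\<lambda>n. r n / r 0"]) auto
qed

end

section \<open>The hitting time as a measurable function of the walk\<close>

text \<open>
  This holds on every sample path, also where some waiting times fail to be positive, so that the
  intervals between successive jump times may overlap: the walk then follows the first interval that
  contains the given time, and finitely many half-open intervals can be avoided up to a later time.
\<close>
lemma walk_right_continuous:
  assumes "walk X \<tau> t \<omega> = Some a"
  shows "eventually (\<lambda>s. walk X \<tau> s \<omega> = Some a) (at_right t)"
proof -
  define I where "I k = {jump_time X \<tau> k \<omega>..<jump_time X \<tau> (Suc k) \<omega>}" for k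
  have w: "walk X \<tau> s \<omega> = (if \<exists>k. s \<in> I k then Some (X (LEAST k. s \<in> I k) \<omega>) else None)" for s
    by (simp add: walk_def I_def)
  define k where "k = (LEAST k. t \<in> I k)"
  have ex: "\<exists>k. t \<in> I k" and Xk: "X k \<omega> = a"
    using assms by (auto simp: w k_def split: if_splits)
  have tk: "t \<in> I k" using LeastI_ex[OF ex] by (simp add: k_def)
  have stay: "eventually (\<lambda>s. s \<in> I k) (at_right t)"
    using tk unfolding I_def by (auto simp: eventually_at_right_field)
  have avoid: "eventually (\<lambda>s. s \<notin> I j) (at_right t)" if "j < k" for j
  proof -
    have "t \<notin> I j" using not_less_Least[of j "\<lambda>k. t \<in> I k"] that by (simp add: k_def)
    then consider "t < jump_time X \<tau> j \<omega>" | "jump_time X \<tau> (Suc j) \<omega> \<le> t"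
      by (force simp: I_def)
    then show ?thesis
    proof cases
      case 1
      then show ?thesis by (auto simp: I_def eventually_at_right_field)
    next
      case 2
      have "eventually (\<lambda>s. t < s) (at_right t)" by (simp add: eventually_at_right_less)
      then show ?thesis by eventually_elim (use 2 in \<open>auto simp: I_def\<close>)
    qed
  qed
  have "eventually (\<lambda>s. \<forall>j\<in>{..<k}. s \<notin> I j) (at_right t)"
    using avoid by (intro eventually_ball_finite) auto
  with stay show ?thesis
  proof eventually_elim
    case (elim s)
    then have "(LEAST k. s \<in> I k) = k"
      by (intro Least_equality) (auto simp: not_less[symmetric])
    with elim show ?case using Xk by (auto simp: w)
  qed
qed

text \<open>
  By right continuity rational times suffice. Hence \<open>\<theta>\<^sub>n\<close> is a measurable function of the process
  \<open>Y\<^sub>n\<close>, without completing the underlying space, and inherits the independence of the \<open>Y\<^sub>n\<close>.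
\<close>
lemma hitting_theta_eq_rational:
  "hitting_theta Z \<sigma> n \<omega> =
     (INF t\<in>{t\<in>\<rat>. 0 \<le> t}. if walk (Z n) (\<sigma> n) t \<omega> = Some (n - 1) then ennreal t else \<infinity>)"
  (is "?L = (INF t\<in>?Q. ?f t)")
proof (rule antisym)
  show "?L \<le> (INF t\<in>?Q. ?f t)"
    unfolding hitting_theta_def by (intro INF_greatest) (auto intro!: Inf_lower)
  show "(INF t\<in>?Q. ?f t) \<le> ?L"
    unfolding hitting_theta_def
  proof (intro Inf_greatest, clarify)
    fix t :: real
    assume t: "0 \<le> t" and w: "walk (Z n) (\<sigma> n) t \<omega> = Some (n - 1)"
    obtain b where b: "b > t" "\<And>y. t < y \<Longrightarrow> y < b \<Longrightarrow> walk (Z n) (\<sigma> n) y \<omega> = Some (n - 1)"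
      using walk_right_continuous[OF w] by (auto simp: eventually_at_right_field)
    show "(INF t\<in>?Q. ?f t) \<le> ennreal t"
    proof (rule ennreal_le_epsilon)
      fix e :: real assume e: "0 < e"
      obtain r where r: "r \<in> \<rat>" "t < r" "r < min b (t + e)"
        using Rats_dense_in_real[of t "min b (t + e)"] b(1) e by auto
      have "(INF t\<in>?Q. ?f t) \<le> ?f r" using r t by (intro INF_lower) auto
      also have "\<dots> \<le> ennreal (t + e)" using b(2)[of r] r by (auto intro!: ennreal_leI)
      finally show "(INF t\<in>?Q. ?f t) \<le> ennreal t + ennreal e" using t e by (simp add: ennreal_plus)
    qed
  qed
qed

section \<open>Laplace transform of the hitting time along a sample path\<close>

text \<open>
  \<open>exp (- c * x)\<close> extended to \<open>[0,\<infinity>]\<close> by 0 at infinity, also for \<open>c = 0\<close>, where it is the indicator of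
  \<open>x < \<infinity>\<close>. The case \<open>c = 0\<close> serves to show that the hitting times are finite.
\<close>
definition exp_neg :: "real \<Rightarrow> ennreal \<Rightarrow> ennreal" where
  "exp_neg c x = (if x = \<infinity> then 0 else ennreal (exp (- c * enn2real x)))"

lemma measurable_exp_neg [measurable]: "exp_neg c \<in> borel_measurable borel"
  unfolding exp_neg_def by measurable

lemma exp_neg_add: "exp_neg c (x + y) = exp_neg c x * exp_neg c y"
  by (cases x; cases y)
     (auto simp: exp_neg_def ennreal_mult[symmetric] exp_add[symmetric] algebra_simps simp flip: ennreal_plus)

lemma exp_neg_0: "exp_neg c 0 = 1"
  by (simp add: exp_neg_def)

lemma exp_neg_sum: "finite A \<Longrightarrow> exp_neg c (sum f A) = (\<Prod>i\<in>A. exp_neg c (f i))"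
  by (induction A rule: finite_induct) (auto simp: exp_neg_add exp_neg_0)

lemma exp_neg_antimono: "0 \<le> c \<Longrightarrow> x \<le> y \<Longrightarrow> exp_neg c y \<le> exp_neg c x"
  by (cases x; cases y) (auto simp: exp_neg_def top_unique intro!: ennreal_leI mult_left_mono)

lemma exp_neg_le_1: "0 \<le> c \<Longrightarrow> exp_neg c x \<le> 1"
  using exp_neg_antimono[of c 0 x] by (simp add: exp_neg_0)

text \<open>
  \<open>damped_hit c a x w m k\<close> is \<open>exp (- c * t)\<close>, where \<open>t\<close> is the time that the path \<open>x\<close> with waiting times
  \<open>w\<close> takes from step \<open>k\<close> to its first visit to \<open>a\<close>, if this visit occurs within \<open>m\<close> steps; otherwise
  it is 0. The recursion follows that of \<open>first_passage\<close>.
\<close>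
primrec damped_hit :: "real \<Rightarrow> nat \<Rightarrow> (nat \<Rightarrow> nat) \<Rightarrow> (nat \<Rightarrow> real) \<Rightarrow> nat \<Rightarrow> nat \<Rightarrow> ennreal" where
  "damped_hit c a x w 0 k = (if x k = a then 1 else 0)"
| "damped_hit c a x w (Suc m) k =
     (if x k = a then 1 else ennreal (exp (- c * w k)) * damped_hit c a x w m (Suc k))"

lemma damped_hit_mono: "damped_hit c a x w m k \<le> damped_hit c a x w (Suc m) k"
proof (induction m arbitrary: k)
  case (Suc m)
  have "ennreal (exp (- c * w k)) * damped_hit c a x w m (Suc k)
      \<le> ennreal (exp (- c * w k)) * damped_hit c a x w (Suc m) (Suc k)"
    by (intro mult_left_mono Suc) simp
  then show ?case by simp
qed simp

lemma damped_hit_hit: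
  "x (k + l) = a \<Longrightarrow> (\<And>j. j < l \<Longrightarrow> x (k + j) \<noteq> a) \<Longrightarrow>
   damped_hit c a x w m k = (if l \<le> m then ennreal (exp (- c * (\<Sum>j<l. w (k + j)))) else 0)"
proof (induction m arbitrary: k l)
  case 0
  then show ?case by (cases l) force+
next
  case (Suc m)
  show ?case
  proof (cases l)
    case 0
    then show ?thesis using Suc.prems by simp
  next
    case (Suc l')
    have "x k \<noteq> a" using Suc.prems(2)[of 0] Suc by simp
    moreover have "damped_hit c a x w m (Suc k)
        = (if l' \<le> m then ennreal (exp (- c * (\<Sum>j<l'. w (Suc k + j)))) else 0)"
      using Suc.prems(2)[of "Suc _"] by (intro Suc.IH) (use Suc.prems Suc in auto)
    moreover have "(\<Sum>j<Suc l'. w (k + j)) = w k + (\<Sum>j<l'. w (Suc k + j))"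
      by (subst sum.lessThan_Suc_shift) simp
    ultimately show ?thesis
      by (simp add: Suc ennreal_mult[symmetric] exp_add[symmetric] algebra_simps)
  qed
qed

lemma damped_hit_no_hit: "(\<And>j. x (k + j) \<noteq> a) \<Longrightarrow> damped_hit c a x w m k = 0"
proof (induction m arbitrary: k)
  case 0
  then show ?case using 0[of 0] by simp
next
  case (Suc m)
  have "damped_hit c a x w m (Suc k) = 0" using Suc.prems[of "Suc _"] by (intro Suc.IH) simp
  then show ?case using Suc.prems[of 0] by simp
qed

lemma exp_neg_hitting_theta:
  assumes c: "0 \<le> c" and pos: "\<And>k. waiting (Z n) (\<sigma> n) k \<omega> > 0"
  shows "exp_neg c (hitting_theta Z \<sigma> n \<omega>) =
    (SUP m. damped_hit c (n - 1) (\<lambda>k. Z n k \<omega>) (\<lambda>k. waiting (Z n) (\<sigma> n) k \<omega>) m 0)"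
proof -
  define T where "T k = jump_time (Z n) (\<sigma> n) k \<omega>" for k
  define S where "S = {ennreal t |t. 0 \<le> t \<and> walk (Z n) (\<sigma> n) t \<omega> = Some (n - 1)}"
  have theta: "hitting_theta Z \<sigma> n \<omega> = Inf S" by (simp add: hitting_theta_def S_def)
  have Tmono: "strict_mono T"
    using pos by (auto intro!: strict_monoI_Suc simp: T_def jump_time_def)
  have T0: "T 0 = 0" by (simp add: T_def jump_time_def)
  have Tnn: "0 \<le> T k" for k using strict_mono_mono[OF Tmono, THEN monoD, of 0 k] T0 by simp
  have uniq: "j = k" if "t \<in> {T j..<T (Suc j)}" "t \<in> {T k..<T (Suc k)}" for t j k
  proof (rule antisym; rule ccontr)
    assume "\<not> j \<le> k"
    then have "T (Suc k) \<le> T j" using strict_mono_less_eq[OF Tmono] by simp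
    with that show False by simp
  next
    assume "\<not> k \<le> j"
    then have "T (Suc j) \<le> T k" using strict_mono_less_eq[OF Tmono] by simp
    with that show False by simp
  qed
  have walk_at: "walk (Z n) (\<sigma> n) t \<omega> = Some (Z n k \<omega>)" if "t \<in> {T k..<T (Suc k)}" for t k
  proof -
    have "(LEAST k. t \<in> {T k..<T (Suc k)}) = k"
    proof (rule Least_equality)
      show "t \<in> {T k..<T (Suc k)}" by (rule that)
    next
      fix j assume "t \<in> {T j..<T (Suc j)}"
      then have "j = k" by (rule uniq[OF _ that])
      then show "k \<le> j" by simp
    qed
    then show ?thesis using that unfolding walk_def T_def[symmetric] by auto
  qed
  have walk_ex: "\<exists>k. t \<in> {T k..<T (Suc k)} \<and> Z n k \<omega> = a" if w: "walk (Z n) (\<sigma> n) t \<omega> = Some a" for t a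
  proof -
    obtain k where k: "t \<in> {T k..<T (Suc k)}"
      using w by (auto simp: walk_def T_def split: if_splits)
    with walk_at[OF k] w show ?thesis by auto
  qed
  show ?thesis
  proof (cases "\<exists>k. Z n k \<omega> = n - 1")
    case True
    define K where "K = (LEAST k. Z n k \<omega> = n - 1)"
    have K: "Z n K \<omega> = n - 1" using LeastI_ex[OF True] by (simp add: K_def)
    have less: "Z n j \<omega> \<noteq> n - 1" if "j < K" for j using not_less_Least that by (auto simp: K_def)
    have "Inf S = ennreal (T K)"
    proof (rule antisym)
      have "T K \<in> {T K..<T (Suc K)}" using strict_mono_less[OF Tmono] by simp
      then show "Inf S \<le> ennreal (T K)"
        using walk_at[of "T K" K] K Tnn by (intro Inf_lower) (auto simp: S_def)
      show "ennreal (T K) \<le> Inf S"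
      proof (intro Inf_greatest)
        fix y assume "y \<in> S"
        then obtain t where t: "y = ennreal t" "0 \<le> t" "walk (Z n) (\<sigma> n) t \<omega> = Some (n - 1)"
          by (auto simp: S_def)
        obtain k where k: "t \<in> {T k..<T (Suc k)}" "Z n k \<omega> = n - 1" using walk_ex[OF t(3)] by auto
        have "K \<le> k" using less[of k] k(2) by (metis not_less)
        then have "T K \<le> T k" using strict_mono_less_eq[OF Tmono] by simp
        then show "ennreal (T K) \<le> y" using k t by (auto intro!: ennreal_leI)
      qed
    qed
    moreover have "(SUP m. damped_hit c (n - 1) (\<lambda>k. Z n k \<omega>) (\<lambda>k. waiting (Z n) (\<sigma> n) k \<omega>) m 0)
        = ennreal (exp (- c * T K))"
    proof -
      have *: "damped_hit c (n - 1) (\<lambda>k. Z n k \<omega>) (\<lambda>k. waiting (Z n) (\<sigma> n) k \<omega>) m 0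
        = (if K \<le> m then ennreal (exp (- c * T K)) else 0)" for m
        using damped_hit_hit[of "\<lambda>k. Z n k \<omega>" 0 K "n - 1" c "\<lambda>k. waiting (Z n) (\<sigma> n) k \<omega>" m] K less
        by (simp add: T_def jump_time_def)
      show ?thesis unfolding *
      proof (rule antisym)
        show "(SUP m. if K \<le> m then ennreal (exp (- c * T K)) else 0) \<le> ennreal (exp (- c * T K))"
          by (rule SUP_least) simp
        show "ennreal (exp (- c * T K)) \<le> (SUP m. if K \<le> m then ennreal (exp (- c * T K)) else 0)"
          by (rule SUP_upper2[of K]) auto
      qed
    qed
    ultimately show ?thesis using Tnn by (simp add: theta exp_neg_def)
  next
    case False
    then have "S = {}" using walk_ex by (fastforce simp: S_def)
    moreover have "damped_hit c (n - 1) (\<lambda>k. Z n k \<omega>) (\<lambda>k. waiting (Z n) (\<sigma> n) k \<omega>) m 0 = 0" for m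
      using False by (intro damped_hit_no_hit) auto
    ultimately show ?thesis by (simp add: theta exp_neg_def)
  qed
qed

section \<open>Averaging over the chain and the waiting times\<close>

lemma (in prob_space) indep_set_nn_integral:
  assumes ind: "indep_set (sets A) (sets B)" and sp: "space B = space M"
    and E: "E \<in> sets A" and f: "f \<in> borel_measurable B"
  shows "(\<integral>\<^sup>+\<omega>. indicator E \<omega> * f \<omega> \<partial>M) = emeasure M E * (\<integral>\<^sup>+\<omega>. f \<omega> \<partial>M)"
proof -
  have subA: "sets A \<subseteq> events" and subB: "sets B \<subseteq> events" using ind by (auto simp: indep_sets2_eq)
  have E': "E \<in> events" using E subA by auto
  have mM: "g \<in> borel_measurable M" if "g \<in> borel_measurable B" for g :: "'a \<Rightarrow> ennreal"
    using that subB sp by (auto simp: measurable_def)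
  note E' [measurable]
  show ?thesis using f
  proof (induction rule: borel_measurable_induct)
    case (cong f g)
    have eq: "f \<omega> = g \<omega>" if "\<omega> \<in> space M" for \<omega> using cong(3) that by (simp add: sp)
    have "(\<integral>\<^sup>+\<omega>. indicator E \<omega> * f \<omega> \<partial>M) = (\<integral>\<^sup>+\<omega>. indicator E \<omega> * g \<omega> \<partial>M)"
      by (intro nn_integral_cong) (simp add: eq)
    also have "\<dots> = emeasure M E * (\<integral>\<^sup>+\<omega>. g \<omega> \<partial>M)" by (rule cong(4))
    also have "(\<integral>\<^sup>+\<omega>. g \<omega> \<partial>M) = (\<integral>\<^sup>+\<omega>. f \<omega> \<partial>M)"
      by (intro nn_integral_cong) (simp add: eq)
    finally show ?case .
  next
    case (set F)
    then have F: "F \<in> events" using subB by auto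
    have "(\<integral>\<^sup>+\<omega>. indicator E \<omega> * indicator F \<omega> \<partial>M) = emeasure M (E \<inter> F)"
      using E' F by (simp flip: indicator_inter_arith)
    also have "\<dots> = emeasure M E * emeasure M F"
      using indep_setD[OF ind E set] by (simp add: emeasure_eq_measure ennreal_mult)
    finally show ?case using F by simp
  next
    case (mult g c)
    note [measurable] = mM[OF \<open>g \<in> borel_measurable B\<close>]
    have "(\<integral>\<^sup>+\<omega>. indicator E \<omega> * (c * g \<omega>) \<partial>M) = c * (\<integral>\<^sup>+\<omega>. indicator E \<omega> * g \<omega> \<partial>M)"
      by (subst nn_integral_cmult[symmetric]) (auto intro!: nn_integral_cong simp: mult_ac)
    then show ?case using mult by (simp add: nn_integral_cmult mult_ac)
  next
    case (add g h)
    note [measurable] = mM[OF \<open>g \<in> borel_measurable B\<close>] mM[OF \<open>h \<in> borel_measurable B\<close>]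
    show ?case using add by (simp add: nn_integral_add distrib_left)
  next
    case (seq U)
    note [measurable] = mM[OF seq(1)]
    have "(\<integral>\<^sup>+\<omega>. indicator E \<omega> * (SUP i. U i) \<omega> \<partial>M) = (\<integral>\<^sup>+\<omega>. (SUP i. indicator E \<omega> * U i \<omega>) \<partial>M)"
      by (simp add: SUP_mult_left_ennreal image_comp)
    also have "\<dots> = (SUP i. \<integral>\<^sup>+\<omega>. indicator E \<omega> * U i \<omega> \<partial>M)"
      using seq(3) by (intro nn_integral_monotone_convergence_SUP)
        (auto simp: incseq_def le_fun_def intro!: mult_left_mono)
    also have "\<dots> = emeasure M E * (SUP i. \<integral>\<^sup>+\<omega>. U i \<omega> \<partial>M)"
      using seq by (simp add: SUP_mult_left_ennreal)
    also have "(SUP i. \<integral>\<^sup>+\<omega>. U i \<omega> \<partial>M) = (\<integral>\<^sup>+\<omega>. (SUP i. U i) \<omega> \<partial>M)"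
      using seq(3) by (simp add: nn_integral_monotone_convergence_SUP image_comp)
    finally show ?case .
  qed
qed

context bd_data
begin

text \<open>
  The Laplace transform of the waiting time with law \<open>\<mu> s i\<close>, and the weights that an upward and a
  downward step from \<open>i\<close> receive from it.
\<close>
definition laplace :: "real \<Rightarrow> step \<Rightarrow> nat \<Rightarrow> real" where
  "laplace c s i = (\<integral>x. exp (- c * x) \<partial>\<mu> s i)"

definition up_weight :: "real \<Rightarrow> nat \<Rightarrow> real" where
  "up_weight c i = p i * laplace c Up i"

definition down_weight :: "real \<Rightarrow> nat \<Rightarrow> real" where
  "down_weight c i = q i * laplace c Down i"

lemma
  assumes c: "0 \<le> c"
  shows nn_integral_laplace: "(\<integral>\<^sup>+x. ennreal (exp (- c * x)) \<partial>\<mu> s i) = ennreal (laplace c s i)"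
    and laplace_nonneg: "0 \<le> laplace c s i"
    and laplace_le_1: "laplace c s i \<le> 1"
proof -
  interpret W: prob_space "\<mu> s i" by (rule waiting_prob)
  have sb [measurable_cong]: "sets (\<mu> s i) = sets borel" by (rule waiting_sets)
  have meas: "(\<lambda>x. exp (- c * x)) \<in> borel_measurable (\<mu> s i)" by measurable
  have le1: "AE x in \<mu> s i. exp (- c * x) \<le> 1"
    using waiting_pos[of s i] by eventually_elim (use c in auto)
  have int: "integrable (\<mu> s i) (\<lambda>x. exp (- c * x))"
    using le1 by (intro W.integrable_const_bound[where B=1] meas) auto
  show "(\<integral>\<^sup>+x. ennreal (exp (- c * x)) \<partial>\<mu> s i) = ennreal (laplace c s i)"
    unfolding laplace_def by (rule nn_integral_eq_integral[OF int]) auto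
  show "0 \<le> laplace c s i" unfolding laplace_def by (rule integral_nonneg_AE) auto
  have "laplace c s i \<le> (\<integral>x. 1 \<partial>\<mu> s i)"
    unfolding laplace_def using le1 by (intro integral_mono_AE int) auto
  then show "laplace c s i \<le> 1" by (simp add: W.prob_space)
qed

lemma pq_bounds: "p i + q i = 1" "0 \<le> p i" "0 \<le> q i"
  using p0 q0 p_pos[of i] q_pos[of i] p_plus_q[of i] by (cases i; simp)+

lemma damped_walk_weights:
  assumes "0 \<le> c"
  shows "damped_walk p q (up_weight c) (down_weight c)"
  by unfold_locales
    (use laplace_nonneg[OF assms] laplace_le_1[OF assms] pq_bounds p_pos q_pos
      in \<open>auto simp: up_weight_def down_weight_def intro!: mult_left_le\<close>)

end

context bd_ctrw
begin

lemma waiting_times_measurable [measurable]: "\<tau> s i k \<in> borel_measurable M"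
  using waiting_indep by (auto simp: indep_vars_def dest: bspec[of _ _ "(s, i, k)"])

lemma chain_measurable' [measurable]: "X k \<in> measurable M (count_space UNIV)"
  by (rule chain_measurable)

lemma waiting_measurable [measurable]: "waiting X \<tau> k \<in> borel_measurable M"
proof -
  have pick: "(\<lambda>\<omega>. \<tau> s (X k \<omega>) k \<omega>) \<in> borel_measurable M" for s
    using measurable_compose_countable[of "\<lambda>i. \<tau> s i k" M borel "X k"] by simp
  have "{\<omega> \<in> space M. \<exists>i. X k \<omega> = i \<and> X (Suc k) \<omega> = i + 1} \<in> sets M"
    by measurable
  then have "{\<omega> \<in> space M. X (Suc k) \<omega> = X k \<omega> + 1} \<in> sets M" by simp
  then show ?thesis unfolding waiting_def[abs_def] by (intro measurable_If pick)
qed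

lemma damped_hit_measurable:
  "(\<lambda>\<omega>. damped_hit c a (\<lambda>j. X j \<omega>) (\<lambda>j. waiting X \<tau> j \<omega>) m k) \<in> borel_measurable M"
proof (induction m arbitrary: k)
  case (Suc m)
  note [measurable] = Suc
  show ?case by simp
qed simp

lemma AE_waiting_pos: "AE \<omega> in M. \<forall>k. waiting X \<tau> k \<omega> > 0"
proof -
  have "AE \<omega> in M. 0 < \<tau> s i k \<omega>" for s i k
  proof -
    have "AE x in distr M borel (\<tau> s i k). 0 < x"
      unfolding waiting_law by (rule waiting_pos)
    then show ?thesis by (subst (asm) AE_distr_iff) auto
  qed
  then have "AE \<omega> in M. \<forall>i k. 0 < \<tau> Up i k \<omega> \<and> 0 < \<tau> Down i k \<omega>"
    by (simp add: AE_all_countable)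
  then show ?thesis by eventually_elim (auto simp: waiting_def)
qed

text \<open>
  The event that the first \<open>k + 1\<close> states of the chain are \<open>x 0, \<dots>, x k\<close>.
\<close>
definition prefix :: "(nat \<Rightarrow> nat) \<Rightarrow> nat \<Rightarrow> 'a set" where
  "prefix x k = {\<omega> \<in> space M. \<forall>i\<le>k. X i \<omega> = x i}"

lemma prefix_in_sets [measurable]: "prefix x k \<in> sets M"
  unfolding prefix_def by measurable

lemma emeasure_prefix_Suc:
  "emeasure M (prefix x (Suc k)) = emeasure M (prefix x k) * ennreal (bd_trans p q (x k) (x (Suc k)))"
proof (cases "measure M (prefix x k) > 0")
  case True
  have "measure M (prefix x (Suc k)) = measure M {\<omega>\<in>space M. X (Suc k) \<omega> = x (Suc k) \<and> (\<forall>i\<le>k. X i \<omega> = x i)}"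
    by (rule arg_cong[where f="measure M"]) (auto simp: prefix_def le_Suc_eq)
  then have "measure M (prefix x (Suc k)) / measure M (prefix x k) = bd_trans p q (x k) (x (Suc k))"
    using markov[of k x "x (Suc k)"] True by (simp add: cond_prob_def prefix_def)
  then have "measure M (prefix x (Suc k)) = measure M (prefix x k) * bd_trans p q (x k) (x (Suc k))"
    using True by (simp add: field_simps)
  then show ?thesis by (simp add: emeasure_eq_measure ennreal_mult')
next
  case False
  then have z: "measure M (prefix x k) = 0" using measure_nonneg[of M "prefix x k"] by linarith
  have "measure M (prefix x (Suc k)) \<le> measure M (prefix x k)"
    by (rule finite_measure_mono) (auto simp: prefix_def)
  then have "measure M (prefix x (Suc k)) = 0" using z measure_nonneg[of M "prefix x (Suc k)"] by linarith
  with z show ?thesis by (simp add: emeasure_eq_measure)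
qed

abbreviation direction :: "(nat \<Rightarrow> nat) \<Rightarrow> nat \<Rightarrow> step" where
  "direction x j \<equiv> (if x (Suc j) = x j + 1 then Up else Down)"

text \<open>
  Once the path of the chain is prescribed, the waiting times met along it are copies with distinct
  indices \<open>(s, i, j)\<close>, since the step number \<open>j\<close> is part of the index. They are thus independent of each
  other and of the path.
\<close>
lemma nn_integral_prefix:
  assumes c: "0 \<le> c"
  shows "(\<integral>\<^sup>+\<omega>. indicator (prefix x k) \<omega> * (\<Prod>j<k. ennreal (exp (- c * waiting X \<tau> j \<omega>))) \<partial>M)
    = emeasure M (prefix x k) * (\<Prod>j<k. ennreal (laplace c (direction x j) (x j)))"
proof -
  define \<phi> where "\<phi> j = (direction x j, x j, j)" for j
  define chain where "chain = vimage_algebra (space M) (\<lambda>\<omega> k. X k \<omega>) (\<Pi>\<^sub>M k\<in>UNIV. count_space (UNIV :: nat set))"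
  define waits where "waits = vimage_algebra (space M) (\<lambda>\<omega> (s, i, k). \<tau> s i k \<omega>)
    (\<Pi>\<^sub>M j\<in>(UNIV :: (step \<times> nat \<times> nat) set). (borel :: real measure))"
  define f where "f \<omega> = (\<Prod>j<k. ennreal (exp (- c * \<tau> (direction x j) (x j) j \<omega>)))" for \<omega>
  have ind: "indep_set (sets chain) (sets waits)"
    using chain_waiting_indep by (simp add: chain_def waits_def)
  have pre: "prefix x k \<in> sets chain"
  proof -
    have "{f \<in> space (\<Pi>\<^sub>M k\<in>UNIV. count_space (UNIV :: nat set)). \<forall>i\<le>k. f i = x i}
      \<in> sets (\<Pi>\<^sub>M k\<in>UNIV. count_space (UNIV :: nat set))"
      by measurable
    then have "(\<lambda>\<omega> k. X k \<omega>) -` {f \<in> space (\<Pi>\<^sub>M k\<in>UNIV. count_space (UNIV :: nat set)). \<forall>i\<le>k. f i = x i}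
      \<inter> space M \<in> sets chain"
      unfolding chain_def by (rule in_vimage_algebra)
    also have "(\<lambda>\<omega> k. X k \<omega>) -` {f \<in> space (\<Pi>\<^sub>M k\<in>UNIV. count_space (UNIV :: nat set)). \<forall>i\<le>k. f i = x i}
      \<inter> space M = prefix x k"
      by (auto simp: prefix_def space_PiM)
    finally show ?thesis .
  qed
  have f_meas: "f \<in> borel_measurable waits"
  proof -
    have "(\<lambda>\<omega> (s, i, k). \<tau> s i k \<omega>) \<in> measurable waits (\<Pi>\<^sub>M j\<in>(UNIV :: (step \<times> nat \<times> nat) set). (borel :: real measure))"
      unfolding waits_def by (rule measurable_vimage_algebra1) (auto simp: space_PiM)
    moreover have "(\<lambda>y. \<Prod>j<k. ennreal (exp (- c * y (\<phi> j))))
      \<in> borel_measurable (\<Pi>\<^sub>M j\<in>(UNIV :: (step \<times> nat \<times> nat) set). (borel :: real measure))"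
      by measurable
    ultimately have "(\<lambda>\<omega>. \<Prod>j<k. ennreal (exp (- c * (\<lambda>(s, i, k). \<tau> s i k \<omega>) (\<phi> j)))) \<in> borel_measurable waits"
      by (rule measurable_compose)
    then show ?thesis by (simp add: f_def[abs_def] \<phi>_def)
  qed
  have "(\<integral>\<^sup>+\<omega>. indicator (prefix x k) \<omega> * (\<Prod>j<k. ennreal (exp (- c * waiting X \<tau> j \<omega>))) \<partial>M)
    = (\<integral>\<^sup>+\<omega>. indicator (prefix x k) \<omega> * f \<omega> \<partial>M)"
    by (intro nn_integral_cong)
      (auto simp: f_def prefix_def waiting_def indicator_def intro!: prod.cong)
  also have "\<dots> = emeasure M (prefix x k) * (\<integral>\<^sup>+\<omega>. f \<omega> \<partial>M)"
    by (rule indep_set_nn_integral[OF ind _ pre f_meas]) (simp add: waits_def)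
  also have "(\<integral>\<^sup>+\<omega>. f \<omega> \<partial>M) = (\<Prod>j<k. ennreal (laplace c (direction x j) (x j)))"
  proof -
    define Y where "Y t \<omega> = ennreal (exp (- c * (case t of (s, i, k) \<Rightarrow> \<tau> s i k \<omega>)))" for t \<omega>
    have inj: "inj_on \<phi> {..<k}" by (auto simp: inj_on_def \<phi>_def)
    have "indep_vars (\<lambda>_. borel) (\<lambda>t \<omega>. ennreal (exp (- c * ((\<lambda>(s, i, k). \<tau> s i k) t \<omega>)))) (\<phi> ` {..<k})"
      by (rule indep_vars_compose2[OF indep_vars_subset[OF waiting_indep]]) auto
    then have indY: "indep_vars (\<lambda>_. borel) Y (\<phi> ` {..<k})"
      by (rule iffD1[OF indep_vars_cong, rotated -1]) (auto simp: Y_def fun_eq_iff)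
    have Yint: "(\<integral>\<^sup>+\<omega>. Y (s, i, k) \<omega> \<partial>M) = ennreal (laplace c s i)" for s i k
    proof -
      have "(\<integral>\<^sup>+\<omega>. Y (s, i, k) \<omega> \<partial>M) = (\<integral>\<^sup>+y. ennreal (exp (- c * y)) \<partial>distr M borel (\<tau> s i k))"
        unfolding Y_def by (subst nn_integral_distr) auto
      then show ?thesis by (simp add: waiting_law nn_integral_laplace[OF c, simplified])
    qed
    have "(\<integral>\<^sup>+\<omega>. f \<omega> \<partial>M) = (\<integral>\<^sup>+\<omega>. (\<Prod>t\<in>\<phi> ` {..<k}. Y t \<omega>) \<partial>M)"
      by (intro nn_integral_cong) (simp only: f_def prod.reindex[OF inj], simp add: Y_def \<phi>_def)
    also have "\<dots> = (\<Prod>t\<in>\<phi> ` {..<k}. \<integral>\<^sup>+\<omega>. Y t \<omega> \<partial>M)"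
      by (rule indep_vars_nn_integral[OF _ indY]) auto
    also have "\<dots> = (\<Prod>j<k. ennreal (laplace c (direction x j) (x j)))"
      unfolding prod.reindex[OF inj] by (simp add: \<phi>_def Yint)
    finally show ?thesis .
  qed
  finally show ?thesis .
qed

text \<open>
  Conditionally on any initial path the remaining damped passage has mean \<open>first_passage\<close>. Splitting
  over the next state of the chain reproduces the recursion of \<open>first_passage\<close>; quantifying over all
  initial paths makes the induction on \<open>m\<close> work without any shift of the process.
\<close>
lemma nn_integral_prefix_damped_hit:
  assumes c: "0 \<le> c"
  shows "(\<integral>\<^sup>+\<omega>. indicator (prefix x k) \<omega> * (\<Prod>j<k. ennreal (exp (- c * waiting X \<tau> j \<omega>)))
       * damped_hit c a (\<lambda>j. X j \<omega>) (\<lambda>j. waiting X \<tau> j \<omega>) m k \<partial>M)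
    = emeasure M (prefix x k) * (\<Prod>j<k. ennreal (laplace c (direction x j) (x j)))
       * ennreal (first_passage (up_weight c) (down_weight c) a m (x k))"
proof (induction m arbitrary: x k)
  case 0
  have "(\<integral>\<^sup>+\<omega>. indicator (prefix x k) \<omega> * (\<Prod>j<k. ennreal (exp (- c * waiting X \<tau> j \<omega>)))
       * damped_hit c a (\<lambda>j. X j \<omega>) (\<lambda>j. waiting X \<tau> j \<omega>) 0 k \<partial>M)
     = (\<integral>\<^sup>+\<omega>. indicator (prefix x k) \<omega> * (\<Prod>j<k. ennreal (exp (- c * waiting X \<tau> j \<omega>)))
       * (if x k = a then 1 else 0) \<partial>M)"
    by (intro nn_integral_cong) (auto simp: prefix_def indicator_def)
  also have "\<dots> = (\<integral>\<^sup>+\<omega>. indicator (prefix x k) \<omega> * (\<Prod>j<k. ennreal (exp (- c * waiting X \<tau> j \<omega>))) \<partial>M)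
       * (if x k = a then 1 else 0)"
    by (rule nn_integral_multc) measurable
  finally show ?case by (simp add: nn_integral_prefix[OF c, simplified])
next
  case (Suc m)
  interpret D: damped_walk p q "up_weight c" "down_weight c" by (rule damped_walk_weights[OF c])
  let ?F = "first_passage (up_weight c) (down_weight c) a"
  let ?R = "\<lambda>m k \<omega>. damped_hit c a (\<lambda>j. X j \<omega>) (\<lambda>j. waiting X \<tau> j \<omega>) m k"
  let ?C = "\<lambda>x k. emeasure M (prefix x k) * (\<Prod>j<k. ennreal (laplace c (direction x j) (x j)))"
  let ?E = "\<lambda>x k \<omega>. indicator (prefix x k) \<omega> * (\<Prod>j<k. ennreal (exp (- c * waiting X \<tau> j \<omega>)))"
  have Fnn: "0 \<le> ?F m i" for m i using D.first_passage_bounds by auto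
  show ?case
  proof (cases "x k = a")
    case True
    have "(\<integral>\<^sup>+\<omega>. ?E x k \<omega> * ?R (Suc m) k \<omega> \<partial>M) = (\<integral>\<^sup>+\<omega>. ?E x k \<omega> \<partial>M)"
      using True by (intro nn_integral_cong) (auto simp: prefix_def indicator_def)
    then show ?thesis using True by (simp only: nn_integral_prefix[OF c]) simp
  next
    case False
    define b where "b z = ennreal (bd_trans p q (x k) z)
      * ennreal (laplace c (if z = x k + 1 then Up else Down) (x k)) * ennreal (?F m z)" for z
    \<comment> \<open>Only the summand with \<open>z = X (Suc k) \<omega>\<close> is non-zero.\<close>
    have step: "?E x k \<omega> * ?R (Suc m) k \<omega> = (\<Sum>z. ?E (x(Suc k := z)) (Suc k) \<omega> * ?R m (Suc k) \<omega>)"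
      if \<omega>: "\<omega> \<in> space M" for \<omega>
    proof -
      have "(\<Sum>z. ?E (x(Suc k := z)) (Suc k) \<omega> * ?R m (Suc k) \<omega>)
        = (\<Sum>z\<in>{X (Suc k) \<omega>}. ?E (x(Suc k := z)) (Suc k) \<omega> * ?R m (Suc k) \<omega>)"
        by (rule suminf_finite) (auto simp: indicator_def prefix_def)
      also have "\<dots> = ?E x k \<omega> * ?R (Suc m) k \<omega>"
      proof (cases "\<omega> \<in> prefix x k")
        case True
        then have "\<omega> \<in> prefix (x(Suc k := X (Suc k) \<omega>)) (Suc k)" "X k \<omega> \<noteq> a"
          using False by (auto simp: prefix_def le_Suc_eq)
        then show ?thesis using True by (simp add: mult_ac)
      next
        case False
        then have "\<omega> \<notin> prefix (x(Suc k := X (Suc k) \<omega>)) (Suc k)"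
          using \<omega> by (auto simp: prefix_def le_Suc_eq)
        then show ?thesis using False by simp
      qed
      finally show ?thesis ..
    qed
    have C_Suc: "?C (x(Suc k := z)) (Suc k) * ennreal (?F m z) = ?C x k * b z" for z
    proof -
      have pe: "prefix (x(Suc k := z)) k = prefix x k" by (auto simp: prefix_def)
      have "(\<Prod>j<k. ennreal (laplace c (direction (x(Suc k := z)) j) ((x(Suc k := z)) j)))
          = (\<Prod>j<k. ennreal (laplace c (direction x j) (x j)))"
        by (intro prod.cong) auto
      then show ?thesis
        by (simp add: emeasure_prefix_Suc pe b_def mult_ac)
    qed
    have b_sum: "(\<Sum>z. b z) = ennreal (?F (Suc m) (x k))"
    proof -
      have "(\<Sum>z. b z) = (\<Sum>z\<in>{Suc (x k), x k - 1}. b z)"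
        by (rule suminf_finite) (auto simp: b_def bd_trans_def)
      also have "\<dots> = b (Suc (x k)) + b (x k - 1)" by simp
      also have "b (Suc (x k)) = ennreal (up_weight c (x k) * ?F m (Suc (x k)))"
        using laplace_nonneg[OF c] pq_bounds Fnn
        by (simp add: b_def bd_trans_def up_weight_def ennreal_mult)
      \<comment> \<open>For \<open>x k = 0\<close> both sides vanish, because \<open>q 0 = 0\<close>.\<close>
      also have "b (x k - 1) = ennreal (down_weight c (x k) * ?F m (x k - 1))"
        using laplace_nonneg[OF c] pq_bounds Fnn q0
        by (cases "x k") (auto simp: b_def bd_trans_def down_weight_def ennreal_mult)
      also have "ennreal (up_weight c (x k) * ?F m (Suc (x k))) + ennreal (down_weight c (x k) * ?F m (x k - 1))
        = ennreal (?F (Suc m) (x k))"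
        using False Fnn D.u D.d by (simp add: ennreal_plus)
      finally show ?thesis .
    qed
    note [measurable] = damped_hit_measurable
    have "(\<integral>\<^sup>+\<omega>. ?E x k \<omega> * ?R (Suc m) k \<omega> \<partial>M)
      = (\<integral>\<^sup>+\<omega>. (\<Sum>z. ?E (x(Suc k := z)) (Suc k) \<omega> * ?R m (Suc k) \<omega>) \<partial>M)"
      by (intro nn_integral_cong step)
    also have "\<dots> = (\<Sum>z. \<integral>\<^sup>+\<omega>. ?E (x(Suc k := z)) (Suc k) \<omega> * ?R m (Suc k) \<omega> \<partial>M)"
      by (intro nn_integral_suminf) measurable
    also have "\<dots> = (\<Sum>z. ?C x k * b z)"
    proof (intro suminf_cong)
      fix z
      show "(\<integral>\<^sup>+\<omega>. ?E (x(Suc k := z)) (Suc k) \<omega> * ?R m (Suc k) \<omega> \<partial>M) = ?C x k * b z"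
        using Suc.IH[of "x(Suc k := z)" "Suc k"] C_Suc[of z] by (simp only: fun_upd_same)
    qed
    also have "\<dots> = ?C x k * ennreal (?F (Suc m) (x k))"
      by (simp only: ennreal_suminf_cmult b_sum)
    finally show ?thesis .
  qed
qed

lemma expectation_damped_hit:
  assumes c: "0 \<le> c" and start: "\<iota> = return_pmf n"
  shows "(\<integral>\<^sup>+\<omega>. damped_hit c a (\<lambda>j. X j \<omega>) (\<lambda>j. waiting X \<tau> j \<omega>) m 0 \<partial>M)
    = ennreal (first_passage (up_weight c) (down_weight c) a m n)"
proof -
  have "AE y in distr M (count_space UNIV) (X 0). y = n"
    unfolding initial start by (simp add: AE_measure_pmf_iff)
  then have X0: "AE \<omega> in M. X 0 \<omega> = n" by (subst (asm) AE_distr_iff) auto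
  have "emeasure M (prefix (\<lambda>_. n) 0) = 1"
    using X0 by (intro emeasure_eq_1_AE) (auto simp: prefix_def elim: eventually_mono)
  moreover have "(\<integral>\<^sup>+\<omega>. damped_hit c a (\<lambda>j. X j \<omega>) (\<lambda>j. waiting X \<tau> j \<omega>) m 0 \<partial>M)
    = (\<integral>\<^sup>+\<omega>. indicator (prefix (\<lambda>_. n) 0) \<omega> * (\<Prod>j<0. ennreal (exp (- c * waiting X \<tau> j \<omega>)))
       * damped_hit c a (\<lambda>j. X j \<omega>) (\<lambda>j. waiting X \<tau> j \<omega>) m 0 \<partial>M)"
    using X0 by (intro nn_integral_cong_AE) (auto simp: prefix_def elim: eventually_mono)
  ultimately show ?thesis
    by (simp only: nn_integral_prefix_damped_hit[OF c]) simp
qed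

end

text \<open>
  On paths with positive waiting times \<open>exp_neg c \<theta>\<^sub>n\<close> is the increasing limit of \<open>damped_hit\<close>.
\<close>
lemma nn_integral_exp_neg_hitting_theta:
  assumes "bd_ctrw N p q \<mu> (return_pmf n) (Z n) (\<sigma> n)" and c: "0 \<le> c"
  shows "(\<integral>\<^sup>+\<omega>. exp_neg c (hitting_theta Z \<sigma> n \<omega>) \<partial>N) =
    ennreal (passage (bd_data.up_weight p \<mu> c) (bd_data.down_weight q \<mu> c) (n - 1) n)"
proof -
  interpret bd_ctrw N p q \<mu> "return_pmf n" "Z n" "\<sigma> n" by fact
  interpret D: damped_walk p q "up_weight c" "down_weight c" by (rule damped_walk_weights[OF c])
  let ?R = "\<lambda>m \<omega>. damped_hit c (n - 1) (\<lambda>k. Z n k \<omega>) (\<lambda>k. waiting (Z n) (\<sigma> n) k \<omega>) m 0"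
  have "(\<integral>\<^sup>+\<omega>. exp_neg c (hitting_theta Z \<sigma> n \<omega>) \<partial>N) = (\<integral>\<^sup>+\<omega>. (SUP m. ?R m \<omega>) \<partial>N)"
    using AE_waiting_pos by (intro nn_integral_cong_AE) (auto elim!: eventually_mono simp: exp_neg_hitting_theta[OF c])
  also have "\<dots> = (SUP m. \<integral>\<^sup>+\<omega>. ?R m \<omega> \<partial>N)"
    by (intro nn_integral_monotone_convergence_SUP damped_hit_measurable)
      (auto intro!: incseq_SucI le_funI damped_hit_mono)
  also have "\<dots> = (SUP m. ennreal (D.F (n - 1) m n))"
    by (simp only: expectation_damped_hit[OF c refl])
  also have "\<dots> = ennreal (D.\<Phi> (n - 1) n)"
  proof (rule LIMSEQ_unique)
    show "(\<lambda>m. ennreal (D.F (n - 1) m n)) \<longlonglongrightarrow> (SUP m. ennreal (D.F (n - 1) m n))"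
      using D.first_passage_mono by (intro LIMSEQ_SUP incseq_SucI ennreal_leI)
    show "(\<lambda>m. ennreal (D.F (n - 1) m n)) \<longlonglongrightarrow> ennreal (D.\<Phi> (n - 1) n)"
      using D.first_passage_tendsto by (rule tendsto_ennrealI)
  qed
  finally show ?thesis .
qed

section \<open>The alternative for the implosion time\<close>

text \<open>
  If \<open>\<Sum>(1 - exp (- x k))\<close> converges then \<open>exp (- x k) > 1/2\<close> eventually, and
  \<open>x * exp (- x) \<le> 1 - exp (- x)\<close> gives \<open>x k \<le> 2 * (1 - exp (- x k))\<close> from there on.
\<close>
lemma suminf_finite_if_exp_defect:
  fixes x :: "nat \<Rightarrow> ennreal"
  assumes fin: "\<And>k. x k \<noteq> \<infinity>" and sum: "(\<Sum>k. 1 - exp_neg 1 (x k)) \<noteq> \<infinity>"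
  shows "(\<Sum>k. x k) \<noteq> \<infinity>"
proof -
  define r where "r k = enn2real (x k)" for k
  have x: "x k = ennreal (r k)" and r0: "0 \<le> r k" for k
    using fin[of k] by (auto simp: r_def ennreal_enn2real_if)
  have d: "1 - exp_neg 1 (x k) = ennreal (1 - exp (- r k))" for k
    unfolding x using r0[of k] by (simp add: exp_neg_def ennreal_minus ennreal_1[symmetric] del: ennreal_1)
  have sm: "summable (\<lambda>k. 1 - exp (- r k))"
    using sum r0 unfolding d by (intro summable_suminf_not_top) auto
  have "eventually (\<lambda>k. 1 - exp (- r k) < 1 / 2) sequentially"
    by (rule order_tendstoD(2)[OF summable_LIMSEQ_zero[OF sm]]) simp
  then have "eventually (\<lambda>k. norm (r k) \<le> 2 * (1 - exp (- r k))) sequentially"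
  proof eventually_elim
    case (elim k)
    have "exp (- r k) * (1 + r k) \<le> exp (- r k) * exp (r k)"
      by (intro mult_left_mono exp_ge_add_one_self) auto
    also have "\<dots> = 1" by (simp flip: exp_add)
    finally have "r k * exp (- r k) \<le> 1 - exp (- r k)" by (simp add: algebra_simps)
    moreover have "r k * (1 / 2) \<le> r k * exp (- r k)"
      using elim r0[of k] by (intro mult_left_mono) auto
    ultimately show ?case using r0[of k] by simp
  qed
  then have "summable r"
    by (rule summable_comparison_test_ev) (intro summable_mult sm)
  then show ?thesis unfolding x using r0 by (simp add: ennreal_suminf_neq_top)
qed

context implosion_walks
begin

abbreviation "\<theta> \<equiv> hitting_theta Z \<sigma>"

lemma hitting_theta_indep: "indep_vars (\<lambda>_. borel) \<theta> {1..}"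
proof -
  define \<Theta> :: "nat \<Rightarrow> (real \<Rightarrow> nat option) \<Rightarrow> ennreal"
    where "\<Theta> n y = (INF t\<in>{t\<in>\<rat>. 0 \<le> t}. if y t = Some (n - 1) then ennreal t else \<infinity>)" for n y
  have meas: "\<Theta> n \<in> borel_measurable (\<Pi>\<^sub>M t\<in>{0..}. count_space UNIV)" for n
    unfolding \<Theta>_def[abs_def]
  proof (rule borel_measurable_INF)
    show "countable {t\<in>\<rat>. 0 \<le> (t::real)}" by (rule countable_subset[OF _ countable_rat]) auto
  next
    fix t :: real assume "t \<in> {t\<in>\<rat>. 0 \<le> t}"
    then have [measurable]: "(\<lambda>y. y t) \<in> measurable (\<Pi>\<^sub>M t\<in>{0..}. count_space (UNIV :: nat option set)) (count_space UNIV)"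
      by (intro measurable_component_singleton) auto
    show "(\<lambda>y. if y t = Some (n - 1) then ennreal t else \<infinity>)
        \<in> borel_measurable (\<Pi>\<^sub>M t\<in>{0..}. count_space (UNIV :: nat option set))"
      by measurable
  qed
  have "indep_vars (\<lambda>_. borel) (\<lambda>n \<omega>. \<Theta> n (\<lambda>t\<in>{0..}. walk (Z n) (\<sigma> n) t \<omega>)) {1..}"
    by (rule indep_vars_compose2[OF walks_indep meas])
  moreover have "\<Theta> n (\<lambda>t\<in>{0..}. walk (Z n) (\<sigma> n) t \<omega>) = \<theta> n \<omega>" for n \<omega>
    unfolding \<Theta>_def hitting_theta_eq_rational by (rule INF_cong) auto
  ultimately show ?thesis by simp
qed

lemma hitting_theta_measurable [measurable]: "n \<ge> 1 \<Longrightarrow> \<theta> n \<in> borel_measurable N"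
  using hitting_theta_indep by (auto simp: indep_vars_def)

lemma rho_infinity_measurable [measurable]: "rho_infinity Z \<sigma> \<in> borel_measurable N"
  unfolding rho_infinity_def[abs_def] by measurable

lemma is_bd_data: "bd_data p q \<mu>"
  using walks[of 1] by (simp add: bd_ctrw_def)

sublocale bd_data p q \<mu> by (rule is_bd_data)

sublocale D: damped_walk p q "up_weight 1" "down_weight 1"
  by (rule damped_walk_weights) simp

lemma nn_integral_exp_neg_theta: "n \<ge> 1 \<Longrightarrow> 0 \<le> c \<Longrightarrow>
  (\<integral>\<^sup>+\<omega>. exp_neg c (\<theta> n \<omega>) \<partial>N) = ennreal (passage (up_weight c) (down_weight c) (n - 1) n)"
  by (rule nn_integral_exp_neg_hitting_theta[OF walks])

lemma nn_integral_exp_defect: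
  assumes n: "n \<ge> 1" and c: "0 \<le> c"
  shows "(\<integral>\<^sup>+\<omega>. 1 - exp_neg c (\<theta> n \<omega>) \<partial>N) = ennreal (1 - passage (up_weight c) (down_weight c) (n - 1) n)"
proof -
  interpret C: damped_walk p q "up_weight c" "down_weight c" by (rule damped_walk_weights[OF c])
  note [measurable] = hitting_theta_measurable[OF n]
  have "(\<integral>\<^sup>+\<omega>. 1 - exp_neg c (\<theta> n \<omega>) \<partial>N) = (\<integral>\<^sup>+\<omega>. 1 \<partial>N) - (\<integral>\<^sup>+\<omega>. exp_neg c (\<theta> n \<omega>) \<partial>N)"
    by (rule nn_integral_diff) (auto simp: nn_integral_exp_neg_theta[OF n c] exp_neg_le_1[OF c])
  also have "\<dots> = ennreal (1 - C.\<Phi> (n - 1) n)"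
    using ennreal_minus[OF C.passage_bounds(1), of 1 "n - 1" n] by (simp add: nn_integral_exp_neg_theta[OF n c] emeasure_space_1)
  finally show ?thesis .
qed

lemma nu_eq: "D.nu = speed_nu p q \<mu>"
  by (rule ext)
    (simp add: D.nu_def speed_nu_def exp_waiting_def up_weight_def down_weight_def laplace_def algebra_simps)

lemma series_eq: "D.series = implosion_series p q \<mu>"
  by (simp add: D.series_def implosion_series_def nu_eq)

text \<open>
  By independence \<open>E (exp (- (\<theta>\<^sub>1 + \<dots> + \<theta>\<^sub>n))) = G n\<close>, so \<open>exp (- \<rho>)\<close> has mean 0.
\<close>
lemma AE_rho_infinite:
  assumes "D.G \<longlonglongrightarrow> 0"
  shows "AE \<omega> in N. rho_infinity Z \<sigma> \<omega> = \<infinity>"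
proof -
  have le: "(\<integral>\<^sup>+\<omega>. exp_neg 1 (rho_infinity Z \<sigma> \<omega>) \<partial>N) \<le> ennreal (D.G n)" for n
  proof -
    have "(\<integral>\<^sup>+\<omega>. exp_neg 1 (rho_infinity Z \<sigma> \<omega>) \<partial>N) \<le> (\<integral>\<^sup>+\<omega>. (\<Prod>k\<in>{1..n}. exp_neg 1 (\<theta> k \<omega>)) \<partial>N)"
    proof (rule nn_integral_mono)
      fix \<omega>
      have "(\<Sum>k\<in>{1..n}. \<theta> k \<omega>) = (\<Sum>k<n. \<theta> (Suc k) \<omega>)"
        by (rule sum.reindex_bij_witness[of _ Suc "\<lambda>k. k - 1"]) auto
      also have "\<dots> \<le> rho_infinity Z \<sigma> \<omega>"
        unfolding rho_infinity_def by (rule sum_le_suminf) auto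
      finally have "exp_neg 1 (rho_infinity Z \<sigma> \<omega>) \<le> exp_neg 1 (\<Sum>k\<in>{1..n}. \<theta> k \<omega>)"
        by (intro exp_neg_antimono) auto
      then show "exp_neg 1 (rho_infinity Z \<sigma> \<omega>) \<le> (\<Prod>k\<in>{1..n}. exp_neg 1 (\<theta> k \<omega>))"
        by (simp add: exp_neg_sum)
    qed
    also have "\<dots> = (\<Prod>k\<in>{1..n}. \<integral>\<^sup>+\<omega>. exp_neg 1 (\<theta> k \<omega>) \<partial>N)"
    proof (rule indep_vars_nn_integral)
      show "indep_vars (\<lambda>_. borel) (\<lambda>k \<omega>. exp_neg 1 (\<theta> k \<omega>)) {1..n}"
        by (rule indep_vars_compose2[OF indep_vars_subset[OF hitting_theta_indep]]) auto
    qed auto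
    also have "\<dots> = ennreal (D.G n)"
      unfolding D.G_def using D.passage_bounds by (subst prod_ennreal[symmetric]) (auto simp: nn_integral_exp_neg_theta)
    finally show ?thesis .
  qed
  have "(\<lambda>n. ennreal (D.G n)) \<longlonglongrightarrow> ennreal 0"
    using assms by (rule tendsto_ennrealI)
  then have "(\<integral>\<^sup>+\<omega>. exp_neg 1 (rho_infinity Z \<sigma> \<omega>) \<partial>N) \<le> ennreal 0"
    using le by (intro LIMSEQ_le_const) auto
  then have "(\<integral>\<^sup>+\<omega>. exp_neg 1 (rho_infinity Z \<sigma> \<omega>) \<partial>N) = 0" by simp
  then have "AE \<omega> in N. exp_neg 1 (rho_infinity Z \<sigma> \<omega>) = 0"
    by (subst (asm) nn_integral_0_iff_AE) auto
  then show ?thesis by eventually_elim (auto simp: exp_neg_def split: if_splits)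
qed

text \<open>
  At \<open>c = 0\<close> there is no killing, the speed measure vanishes, and the bound on the defect says that the
  recurrent chain started at \<open>n\<close> almost surely hits \<open>n - 1\<close>.
\<close>
lemma AE_hitting_theta_finite:
  assumes rec: "\<not> summable (scale_delta p q)" and n: "n \<ge> 1"
  shows "AE \<omega> in N. \<theta> n \<omega> \<noteq> \<infinity>"
proof -
  interpret C: damped_walk p q "up_weight 0" "down_weight 0" by (rule damped_walk_weights) simp
  note [measurable] = hitting_theta_measurable[OF n]
  have "laplace 0 s i = 1" for s i
    using prob_space.prob_space[OF waiting_prob[of s i]] by (simp add: laplace_def)
  then have "C.nu = (\<lambda>_. 0)"
    using pq_bounds(1) by (auto simp: C.nu_def up_weight_def down_weight_def algebra_simps)
  then have "1 - C.\<Phi> (n - 1) n \<le> 0"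
    using C.defect_le_speed_tail[OF n rec] by simp
  then have "(\<integral>\<^sup>+\<omega>. 1 - exp_neg 0 (\<theta> n \<omega>) \<partial>N) = 0"
    by (simp add: nn_integral_exp_defect[OF n] ennreal_neg)
  then have "AE \<omega> in N. 1 - exp_neg 0 (\<theta> n \<omega>) = 0"
    by (subst (asm) nn_integral_0_iff_AE) auto
  then show ?thesis by eventually_elim (auto simp: exp_neg_def)
qed

text \<open>
  The implosion series bounds \<open>\<Sum>E (1 - exp (- \<theta>\<^sub>n))\<close>. This direction does not use independence.
\<close>
lemma AE_rho_finite:
  assumes fin: "implosion_series p q \<mu> < \<infinity>" and rec: "\<not> summable (scale_delta p q)"
  shows "AE \<omega> in N. rho_infinity Z \<sigma> \<omega> \<noteq> \<infinity>"
proof -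
  let ?\<delta> = "scale_delta p q"
  have sm: "summable D.nu"
  proof -
    have "(\<Sum>i. ennreal (D.nu (0 + 1 + i))) * ennreal (?\<delta> 0) \<le> D.series"
      unfolding D.series_def
      using sum_le_suminf[of "\<lambda>k. (\<Sum>i. ennreal (D.nu (k + 1 + i))) * ennreal (?\<delta> k)" "{0}"] by simp
    then have "(\<Sum>i. ennreal (D.nu (i + 1))) \<noteq> \<infinity>"
      using fin by (auto simp: D.delta_0 series_eq top_unique)
    then have "summable (\<lambda>i. D.nu (i + 1))"
      using D.nu_nonneg by (intro summable_suminf_not_top) auto
    then show ?thesis by (simp only: summable_iff_shift)
  qed
  have meas: "(\<lambda>\<omega>. 1 - exp_neg 1 (\<theta> (Suc k) \<omega>)) \<in> borel_measurable N" for k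
  proof -
    have [measurable]: "\<theta> (Suc k) \<in> borel_measurable N" by simp
    show ?thesis by measurable
  qed
  have "(\<integral>\<^sup>+\<omega>. (\<Sum>k. 1 - exp_neg 1 (\<theta> (Suc k) \<omega>)) \<partial>N) = (\<Sum>k. \<integral>\<^sup>+\<omega>. 1 - exp_neg 1 (\<theta> (Suc k) \<omega>) \<partial>N)"
    by (rule nn_integral_suminf[OF meas])
  also have "\<dots> \<le> D.series"
    unfolding D.series_def
  proof (intro suminf_le)
    fix k
    have sm': "summable (\<lambda>i. D.nu (k + 1 + i))"
      using summable_ignore_initial_segment[OF sm, of "k + 1"] by (simp add: add_ac)
    have "(\<integral>\<^sup>+\<omega>. 1 - exp_neg 1 (\<theta> (Suc k) \<omega>) \<partial>N) = ennreal (1 - D.\<Phi> k (Suc k))"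
      using nn_integral_exp_defect[of "Suc k" 1] by simp
    also have "\<dots> \<le> ennreal ((\<Sum>i. D.nu (k + 1 + i)) * ?\<delta> k)"
      using D.defect_le_speed_tail[of "Suc k", OF _ rec sm] by (intro ennreal_leI) (simp add: mult.commute)
    also have "\<dots> = (\<Sum>i. ennreal (D.nu (k + 1 + i))) * ennreal (?\<delta> k)"
      using suminf_nonneg[OF sm' D.nu_nonneg] D.delta_pos[of k]
      by (simp only: suminf_ennreal2[OF D.nu_nonneg sm'] ennreal_mult less_imp_le)
    finally show "(\<integral>\<^sup>+\<omega>. 1 - exp_neg 1 (\<theta> (Suc k) \<omega>) \<partial>N) \<le> (\<Sum>i. ennreal (D.nu (k + 1 + i))) * ennreal (?\<delta> k)" .
  qed auto
  also have "\<dots> < \<infinity>" using fin by (simp add: series_eq)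
  finally have "AE \<omega> in N. (\<Sum>k. 1 - exp_neg 1 (\<theta> (Suc k) \<omega>)) \<noteq> \<infinity>"
    using meas by (intro nn_integral_PInf_AE borel_measurable_suminf_order) auto
  moreover have "AE \<omega> in N. \<forall>k. \<theta> (Suc k) \<omega> \<noteq> \<infinity>"
    unfolding AE_all_countable using AE_hitting_theta_finite[OF rec] by simp
  ultimately show ?thesis
    unfolding rho_infinity_def by eventually_elim (rule suminf_finite_if_exp_defect, auto)
qed

lemma prob_implosion:
  shows "implosion_series p q \<mu> < \<infinity> \<and> (\<Sum>k. ennreal (scale_delta p q k)) = \<infinity>
      \<Longrightarrow> \<P>(\<omega> in N. rho_infinity Z \<sigma> \<omega> < \<infinity>) = 1" (is "?C \<Longrightarrow> ?P1")
    and "\<not> (implosion_series p q \<mu> < \<infinity> \<and> (\<Sum>k. ennreal (scale_delta p q k)) = \<infinity>)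
      \<Longrightarrow> \<P>(\<omega> in N. rho_infinity Z \<sigma> \<omega> < \<infinity>) = 0" (is "_ \<Longrightarrow> ?P0")
proof -
  have delta: "summable (scale_delta p q) \<longleftrightarrow> (\<Sum>k. ennreal (scale_delta p q k)) \<noteq> \<infinity>"
    using D.delta_pos by (auto intro: summable_suminf_not_top simp: ennreal_suminf_neq_top less_imp_le)
  show ?P1 if ?C
  proof -
    have "AE \<omega> in N. rho_infinity Z \<sigma> \<omega> \<noteq> \<infinity>" using that delta by (intro AE_rho_finite) auto
    then show ?thesis by (subst prob_Collect_eq_1) (auto simp: top.not_eq_extremum)
  qed
  show ?P0 if "\<not> ?C"
  proof -
    have "D.G \<longlonglongrightarrow> 0"
    proof (cases "summable (scale_delta p q)")
      case True
      then show ?thesis by (rule D.G_tendsto_0_of_transient)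
    next
      case False
      then have "D.series = \<infinity>"
        using that delta less_top[of "implosion_series p q \<mu>"] by (auto simp: series_eq)
      then show ?thesis by (rule D.G_tendsto_0_of_series)
    qed
    then have "AE \<omega> in N. rho_infinity Z \<sigma> \<omega> = \<infinity>" by (rule AE_rho_infinite)
    then show ?thesis by (subst prob_Collect_eq_0) auto
  qed
qed

end

theorem theorem3p2:
  fixes M :: "'a measure" and N :: "'b measure"
    and p q :: "nat \<Rightarrow> real" and \<mu> :: "step \<Rightarrow> nat \<Rightarrow> real measure" and \<iota> :: "nat pmf"
    and X :: "nat \<Rightarrow> 'a \<Rightarrow> nat" and \<tau> :: "step \<Rightarrow> nat \<Rightarrow> nat \<Rightarrow> 'a \<Rightarrow> real"
    and Z :: "nat \<Rightarrow> nat \<Rightarrow> 'b \<Rightarrow> nat" and \<sigma> :: "nat \<Rightarrow> step \<Rightarrow> nat \<Rightarrow> nat \<Rightarrow> 'b \<Rightarrow> real"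
  assumes "bd_ctrw M p q \<mu> \<iota> X \<tau>"
    and "implosion_walks N p q \<mu> Z \<sigma>"
  shows "(\<P>(\<omega> in N. rho_infinity Z \<sigma> \<omega> < \<infinity>) = 1 \<longleftrightarrow>
            implosion_series p q \<mu> < \<infinity> \<and> (\<Sum>k. ennreal (scale_delta p q k)) = \<infinity>) \<and>
         (\<P>(\<omega> in N. rho_infinity Z \<sigma> \<omega> < \<infinity>) = 0 \<longleftrightarrow>
            implosion_series p q \<mu> = \<infinity> \<or> (\<Sum>k. ennreal (scale_delta p q k)) < \<infinity>)"
proof -
  interpret implosion_walks N p q \<mu> Z \<sigma> by fact
  have not_C: "implosion_series p q \<mu> = \<infinity> \<or> (\<Sum>k. ennreal (scale_delta p q k)) < \<infinity> \<longleftrightarrow>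
      \<not> (implosion_series p q \<mu> < \<infinity> \<and> (\<Sum>k. ennreal (scale_delta p q k)) = \<infinity>)"
    using less_top[of "implosion_series p q \<mu>"] less_top[of "\<Sum>k. ennreal (scale_delta p q k)"] by auto
  show ?thesis unfolding not_C using prob_implosion by fastforce
qed

end
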